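(* Let $P=(X,\prec)$ be an interval order and let $f:X\to\{1,2\}$ be a weight function. The following are equivalent: (1) $P$ has an interval representation $\{I_x : x\in X\}$ in which $|I_x|=f(x)$ for all $x\in X$. (2) The weighted digraph $G(P,f)$ has no negative weight cycles. (3) None of the weighted posets in the set $\mathcal{F}$ is induced in $(P,f)$.
   Context: A poset $P=(X,\prec)$ is a finite set $X$ of points with an irreflexive, transitive relation $\prec$. Write $x\parallel y$ if $x,y$ are incomparable (distinct points with neither $x\prec y$ nor $y\prec x$). An interval representation of $P$ assigns to each $v\in X$ a closed real interval $I_v$ so that $x\prec y$ if and only if $I_x$ is completely to the left of $I_y$; $|I_v|$ denotes the length of $I_v$. A poset with an interval representation is an interval order. A weighted poset $(P,f)$ is a poset together with a function $f$ from its points to the non-negative reals. A weighted poset $(Q,g)$ is induced in $(P,f)$ if there is an injection from the points of $Q$ into $X$ that preserves and reflects $\prec$ and preserves weights. Weighted digraph: fix $\epsilon$ with $0<\epsilon<1/|X|^2$. $G(P,f)$ is the weighted digraph with vertex set $X$ and arcs: for all $a,b\in X$ with $a\succ b$, the arc $(a,b)$ with weight $-f(b)-\epsilon$; for all distinct $a,b\in X$ with $a\parallel b$, the arc $(a,b)$ with weight $f(a)$ and the arc $(b,a)$ with weight $f(b)$. A cycle is a sequence of distinct vertices $x_1,\dots,x_t$ such that $(x_i,x_{i+1})$ is an arc for $1\le i\le t-1$ and $(x_t,x_1)$ is an arc; its weight is the sum of the weights of its arcs. The set $\mathcal{F}$ of weighted posets (all weights in $\{1,2\}$) consists of the following. (A)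 The poset $\mathbf{3+1}$ with points $a,y,b,x$, where $a\succ y\succ b$ and $x$ is incomparable to $a,y,b$, with any weights in $\{1,2\}$ such that the weight of $y$ is 2 or the weight of $x$ is 1. (B) Four infinite families $\mathcal{F}_1,\mathcal{F}_2,\mathcal{F}_3,\mathcal{F}_4$, indexed by an integer $t\ge 0$. The posets in each family have points $x_1,\dots,x_{t+1},y_0,y_1,\dots,y_{t+1},a,b$, where in $\mathcal{F}_2$ and $\mathcal{F}_4$ we have $a=y_{t+1}$, while in $\mathcal{F}_1$ and $\mathcal{F}_3$ the point $a$ is an additional point; posets in $\mathcal{F}_3$ and $\mathcal{F}_4$ contain also an extra point $x_0$. All points are distinct except for the stated identification. In each family the following comparabilities hold for all $i\ge 0$ for which the points exist: $b\prec y_0$, $y_i\prec y_{i+1}$, $x_i\prec x_{i+2}$, $x_i\prec y_{i+1}$, $y_i\prec x_{i+2}$. Additional comparabilities: in $\mathcal{F}_1$, $y_{t+1}\prec a$; in $\mathcal{F}_2$, none; in $\mathcal{F}_3$, $y_{t+1}\prec a$ and $b\prec x_1$; in $\mathcal{F}_4$, $b\prec x_1$. The order is the transitive closure of these; all other pairs are incomparable. The weights of $a$ and $b$ may each be 1 or 2. The remaining points have weight 2 except for the following points of weight 1: $y_0$ and $y_{t+1}$ in $\mathcal{F}_1$; $y_0$ and $x_{t+1}$ in $\mathcal{F}_2$; $x_0$ and $y_{t+1}$ in $\mathcal{F}_3$; $x_0$ and $x_{t+1}$ in $\mathcal{F}_4$. *)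

theory Defs
  imports "HOL-Analysis.Analysis" "Graph_Theory.Arc_Walk"
begin

text \<open>A poset is a carrier \<open>X\<close> with a strict order \<open>prec\<close>; values of \<open>prec\<close> and of
  weight functions outside the carrier are irrelevant.\<close>

definition poset :: "'a set \<Rightarrow> ('a \<Rightarrow> 'a \<Rightarrow> bool) \<Rightarrow> bool" where
  "poset X prec \<longleftrightarrow> finite X \<and> irreflp_on X prec \<and> transp_on X prec"

definition incomparable :: "('a \<Rightarrow> 'a \<Rightarrow> bool) \<Rightarrow> 'a \<Rightarrow> 'a \<Rightarrow> bool" where
  "incomparable prec x y \<longleftrightarrow> x \<noteq> y \<and> \<not> prec x y \<and> \<not> prec y x"

definition completely_left :: "real set \<Rightarrow> real set \<Rightarrow> bool" where
  "completely_left S T \<longleftrightarrow> (\<forall>s\<in>S. \<forall>t\<in>T. s < t)"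

definition interval_representation ::
    "'a set \<Rightarrow> ('a \<Rightarrow> 'a \<Rightarrow> bool) \<Rightarrow> ('a \<Rightarrow> real set) \<Rightarrow> bool" where
  "interval_representation X prec I \<longleftrightarrow>
     (\<forall>v\<in>X. \<exists>l r. l \<le> r \<and> I v = {l..r}) \<and>
     (\<forall>x\<in>X. \<forall>y\<in>X. prec x y \<longleftrightarrow> completely_left (I x) (I y))"

definition interval_order :: "'a set \<Rightarrow> ('a \<Rightarrow> 'a \<Rightarrow> bool) \<Rightarrow> bool" where
  "interval_order X prec \<longleftrightarrow> poset X prec \<and> (\<exists>I. interval_representation X prec I)"


subsection \<open>The weighted digraph of a weighted poset\<close>

text \<open>The arc \<open>(a, b)\<close> runs from \<open>a\<close> to \<open>b\<close>. An incomparable pair gives both arcs,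
  because incomparability is symmetric.\<close>

definition G_digraph :: "'a set \<Rightarrow> ('a \<Rightarrow> 'a \<Rightarrow> bool) \<Rightarrow> ('a, 'a \<times> 'a) pre_digraph" where
  "G_digraph X prec =
     \<lparr> verts = X,
       arcs = {(a, b). a \<in> X \<and> b \<in> X \<and> (prec b a \<or> incomparable prec a b)},
       tail = fst,
       head = snd \<rparr>"

definition G_weight ::
    "real \<Rightarrow> ('a \<Rightarrow> 'a \<Rightarrow> bool) \<Rightarrow> ('a \<Rightarrow> real) \<Rightarrow> 'a \<times> 'a \<Rightarrow> real" where
  "G_weight \<epsilon> prec f = (\<lambda>(a, b). if prec b a then - f b - \<epsilon> else f a)"

text \<open>A cycle \<open>x\<^sub>1, \<dots>, x\<^sub>t\<close> of distinct vertices is given by its list of arcs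
  \<open>(x\<^sub>1, x\<^sub>2), \<dots>, (x\<^sub>t, x\<^sub>1)\<close>.\<close>

definition negative_cycle :: "('a, 'b) pre_digraph \<Rightarrow> ('b \<Rightarrow> real) \<Rightarrow> 'b list \<Rightarrow> bool" where
  "negative_cycle G w p \<longleftrightarrow> pre_digraph.cycle G p \<and> sum_list (map w p) < 0"


subsection \<open>The forbidden weighted posets\<close>

type_synonym 'a weighted_poset = "'a set \<times> ('a \<Rightarrow> 'a \<Rightarrow> bool) \<times> ('a \<Rightarrow> real)"

fun induced_in :: "'b weighted_poset \<Rightarrow> 'a weighted_poset \<Rightarrow> bool" where
  "induced_in (Y, precQ, g) (X, precP, f) \<longleftrightarrow>
     (\<exists>\<phi>. inj_on \<phi> Y \<and> \<phi> ` Y \<subseteq> X \<and>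
        (\<forall>u\<in>Y. \<forall>v\<in>Y. precQ u v \<longleftrightarrow> precP (\<phi> u) (\<phi> v)) \<and>
        (\<forall>u\<in>Y. g u = f (\<phi> u)))"

text \<open>Names for the points of the forbidden posets.\<close>

datatype point = PX nat | PY nat | PA | PB

definition three_plus_one :: "point weighted_poset set" where
  "three_plus_one =
     {(S, prec, g).
        S = {PA, PY 0, PB, PX 0} \<and>
        prec = (\<lambda>u v. (u, v) \<in> {(PB, PY 0), (PY 0, PA), (PB, PA)}) \<and>
        (\<forall>v\<in>S. g v \<in> {1, 2}) \<and>
        (g (PY 0) = 2 \<or> g (PX 0) = 1)}"

definition common_comparabilities :: "(point \<times> point) set" where
  "common_comparabilities =
     {(PB, PY 0)} \<union> (\<Union>i. {(PY i, PY (i + 1)), (PX i, PX (i + 2)), (PX i, PY (i + 1)), (PY i, PX (i + 2))})"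

text \<open>Comparabilities are restricted to the existing points \<open>S\<close> before the transitive closure
  is taken; \<open>E\<close> holds the additional ones.\<close>

definition generated_order ::
    "point set \<Rightarrow> (point \<times> point) set \<Rightarrow> point \<Rightarrow> point \<Rightarrow> bool" where
  "generated_order S E u v \<longleftrightarrow> (u, v) \<in> ((common_comparabilities \<union> E) \<inter> S \<times> S)\<^sup>+"

text \<open>The point called \<open>a\<close> is a parameter because it is \<open>PY (t + 1)\<close> in the second and fourth
  family. The points in \<open>L\<close> have weight 1.\<close>

definition family_posets ::
    "point \<Rightarrow> point set \<Rightarrow> (point \<times> point) set \<Rightarrow> point set \<Rightarrow> point weighted_poset set" where
  "family_posets a S E L =
     {(S, generated_order S E, g) | g.
        g a \<in> {1, 2} \<and> g PB \<in> {1, 2} \<and>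
        (\<forall>v\<in>S - {a, PB}. g v = (if v \<in> L then 1 else 2))}"

definition core_points :: "nat \<Rightarrow> point set" where
  "core_points t = PX ` {1..t + 1} \<union> PY ` {0..t + 1} \<union> {PB}"

definition F1 :: "nat \<Rightarrow> point weighted_poset set" where
  "F1 t = family_posets PA (core_points t \<union> {PA}) {(PY (t + 1), PA)} {PY 0, PY (t + 1)}"

definition F2 :: "nat \<Rightarrow> point weighted_poset set" where
  "F2 t = family_posets (PY (t + 1)) (core_points t) {} {PY 0, PX (t + 1)}"

definition F3 :: "nat \<Rightarrow> point weighted_poset set" where
  "F3 t = family_posets PA (core_points t \<union> {PA, PX 0}) {(PY (t + 1), PA), (PB, PX 1)} {PX 0, PY (t + 1)}"

definition F4 :: "nat \<Rightarrow> point weighted_poset set" where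
  "F4 t = family_posets (PY (t + 1)) (core_points t \<union> {PX 0}) {(PB, PX 1)} {PX 0, PX (t + 1)}"

definition forbidden :: "point weighted_poset set" where
  "forbidden = three_plus_one \<union> (\<Union>t. F1 t \<union> F2 t \<union> F3 t \<union> F4 t)"

end

theory Submission
  imports Defs "Graph_Theory.Shortest_Path"
begin

text \<open>
  Give every point \<open>x\<close> its left endpoint \<open>L x\<close> as the only unknown. An arc
  \<open>(x, y)\<close> of weight \<open>w\<close> then is the inequality
  \<open>L y \<le> L x + w\<close>, with \<open>\<epsilon>\<close> making up for the strictness of
  \<open>L x > L y + f y\<close>. So a representation is a potential of the digraph, and a potential
  exists if and only if there is no negative cycle. As \<open>f\<close> is integral and
  \<open>\<epsilon>\<close> times the number of points is below 1, a cycle is negative exactly if its weight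
  without the \<open>\<epsilon>\<close> terms is at most 0; such closed walks are called bad.

  A forbidden poset has no representation because it holds two ways from the right end of \<open>b\<close> to
  the left end of \<open>a\<close>: the \<open>x\<close> intervals overlap consecutively, so the distance is at
  most the sum of their lengths, and the \<open>y\<close> intervals lie strictly between \<open>b\<close> and
  \<open>a\<close>, one after the other, so it is larger than the sum of theirs. The weights are chosen to make
  these sums contradict each other.

  Conversely, consider a bad closed walk with the fewest steps. Any two of its points are joined by an arc, in
  one direction at least. Unless they are consecutive, such a chord closes a part of the walk to a shorter
  closed walk, whose weight is positive by minimality. Read the partial sum of weights up to a vertex, its
  level, as a left endpoint. Positivity of the chords then says that the walk itself is almost a representation:
  two points that are not consecutive are ordered as their intervals of levels, and a left end of one never
  meets a right end of the other (\<open>level_gap\<close>). This is very restrictive, because levels change by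
  at most 2 in a step, so that two passages of the walk through the same levels are forced to meet in a common
  level. Hence the walk is one ascent along incomparable points, the \<open>x\<close> chain, followed by one
  descent, the \<open>y\<close> chain (\<open>above_root\<close>, \<open>single_run\<close>). If it has more
  than four points, its weight is exactly 0, so both chains tile the same interval of levels by intervals of
  length 1 and 2 without a common inner endpoint. That leaves the odd levels to one chain and the even levels to
  the other (\<open>interleave\<close>). All tiles then have length 2, except those cut off by the two ends of
  the interval, and the parities of the ends give the four families (\<open>family_induced\<close>). Four points
  give \<open>3 + 1\<close>. Being an interval order, that is, having no induced \<open>2 + 2\<close>, is
  used to exclude ascents and descents that consist of one arc only.
\<close>

section \<open>Integer sequences with small steps\<close>

lemma int_crossing_up:
  fixes g :: "nat \<Rightarrow> int"
  assumes "a \<le> b" "g a \<le> h" "h < g b"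
  shows "\<exists>i. a \<le> i \<and> i < b \<and> g i \<le> h \<and> h < g (Suc i)"
  using assms
proof (induction b rule: dec_induct)
  case base
  then show ?case by simp
next
  case (step k)
  then show ?case by (cases "h < g k") (auto intro: less_SucI)
qed

lemma int_crossing_down:
  fixes g :: "nat \<Rightarrow> int"
  assumes "a \<le> b" "h < g a" "g b \<le> h"
  shows "\<exists>i. a \<le> i \<and> i < b \<and> h < g i \<and> g (Suc i) \<le> h"
proof -
  have "- g a \<le> - h - 1" "- h - 1 < - g b" using assms by linarith+
  from int_crossing_up[of a b "\<lambda>i. - g i", OF assms(1) this]
  obtain i where "a \<le> i" "i < b" "- g i \<le> - h - 1" "- h - 1 < - g (Suc i)" by blast
  moreover from this have "h < g i" "g (Suc i) \<le> h" by linarith+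
  ultimately show ?thesis by blast
qed

lemma increasing_steps:
  fixes x :: "nat \<Rightarrow> int"
  assumes "\<And>i. i < M \<Longrightarrow> x i < x (Suc i)" "i < j" "j \<le> M"
  shows "x i < x j"
proof -
  from \<open>i < j\<close> have "Suc i \<le> j" by simp
  then show ?thesis using \<open>j \<le> M\<close>
  proof (induction j rule: dec_induct)
    case base
    then show ?case using assms(1)[of i] by simp
  next
    case (step j)
    then show ?case using assms(1)[of j] by simp
  qed
qed

text \<open>
  An increasing sequence is read as the boundaries of a tiling, and \<open>x 0\<close> and \<open>x M\<close>
  are the ends of the tiled interval.
\<close>
definition inner_value :: "(nat \<Rightarrow> int) \<Rightarrow> nat \<Rightarrow> int \<Rightarrow> bool" where
  "inner_value x M h \<longleftrightarrow> (\<exists>i. 0 < i \<and> i < M \<and> x i = h)"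

lemma inner_value_or_next:
  assumes steps: "\<And>i. i < M \<Longrightarrow> x (Suc i) = x i + 1 \<or> x (Suc i) = x i + 2"
    and "x 0 < h" "h + 1 < x M"
  shows "inner_value x M h \<or> inner_value x M (h + 1)"
proof -
  obtain i where i: "i < M" "x i \<le> h" "h < x (Suc i)"
    using int_crossing_up[of 0 M x h] assms(2,3) by auto
  show ?thesis
  proof (cases "x i = h")
    case True
    with i assms(2) have "0 < i" by (cases i) auto
    with i True show ?thesis unfolding inner_value_def by blast
  next
    case False
    then have "x (Suc i) = h + 1" using steps[OF i(1)] i by auto
    moreover from this have "Suc i < M" using i assms(3) by (cases "Suc i = M") auto
    ultimately show ?thesis unfolding inner_value_def by blast
  qed
qed

text \<open>
  The sequences \<open>x\<close> and \<open>y\<close> list the boundaries of two tilings of the same interval,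
  by tiles of length 1 and 2. A boundary sequence skips no two consecutive integers, and no inner boundary is
  shared, so (as there are more than two tiles) each inner integer belongs to exactly one of the sequences, and
  neighbouring integers belong to different ones. The first tile of \<open>x\<close> has length
  \<open>\<kappa> + 1\<close>, and the origin is placed such that it ends at an odd number. The result is the
  tiling by \<open>[2 i - 1, 2 i + 1]\<close> and the one by \<open>[2 j, 2 j + 2]\<close>, both
  truncated to the interval; \<open>max\<close> and \<open>min\<close> express the truncation.
\<close>
lemma interleave:
  fixes x y :: "nat \<Rightarrow> int" and \<kappa> :: int
  assumes \<kappa>: "\<kappa> = 0 \<or> \<kappa> = 1"
    and start: "x 0 = \<kappa>" "y 0 = \<kappa>" "x 1 = 2 * \<kappa> + 1"
    and x_steps: "\<And>i. i < M \<Longrightarrow> x (Suc i) = x i + 1 \<or> x (Suc i) = x i + 2"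
    and y_steps: "\<And>j. j < K \<Longrightarrow> y (Suc j) = y j + 1 \<or> y (Suc j) = y j + 2"
    and size: "0 < M" "0 < K" "2 < M + K"
    and finish: "x M = y K"
    and disjoint: "\<And>i j. 0 < i \<Longrightarrow> i < M \<Longrightarrow> 0 < j \<Longrightarrow> j < K \<Longrightarrow> x i \<noteq> y j"
  shows "\<exists>t. int M + \<kappa> = int t + 2 \<and>
    (K = t + 2 \<and> x M = 2 * int t + 3 \<or> K = t + 1 \<and> x M = 2 * int t + 2) \<and>
    (\<forall>i\<le>M. x i = max \<kappa> (min (x M) (2 * (int i + \<kappa>) - 1))) \<and>
    (\<forall>j\<le>K. y j = max \<kappa> (min (x M) (2 * int j)))"
proof -
  have x_less: "x i < x j" if "i < j" "j \<le> M" for i j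
    using increasing_steps[of M x i j] x_steps that by force
  have y_less: "y i < y j" if "i < j" "j \<le> K" for i j
    using increasing_steps[of K y i j] y_steps that by force
  have not_both: "\<not> (inner_value x M h \<and> inner_value y K h)" for h
    using disjoint unfolding inner_value_def by metis
  have x1_inner: "inner_value x M (2 * \<kappa> + 1)" if "2 * \<kappa> + 1 < x M"
  proof -
    have "M \<noteq> 1" using that start by auto
    then show ?thesis using size start(3) unfolding inner_value_def by (intro exI[of _ 1]) auto
  qed
  \<comment> \<open>By induction on \<open>h\<close>: the sequence that misses \<open>h\<close> contains \<open>h + 1\<close>, and then the other one does not.\<close>
  have inner: "(odd h \<longrightarrow> inner_value x M h) \<and> (even h \<longrightarrow> inner_value y K h)"
    if "\<kappa> + 1 \<le> h" "h < x M" for h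
    using that
  proof (induction h rule: int_ge_induct)
    case base
    show ?case
    proof (cases "\<kappa> = 0")
      case True
      then show ?thesis using x1_inner base by simp
    next
      case False
      then have k: "\<kappa> = 1" using \<kappa> by simp
      have "inner_value y K 2"
      proof (cases "x M = 3")
        case True
        then have "M = 1" using x_less[of 1 M] start(3) k size by (cases "M = 1") auto
        then have "1 < K" using size by simp
        moreover have "y 1 = 2"
          using y_less[of 0 1] y_less[of 1 K] \<open>1 < K\<close> start finish True k by auto
        ultimately show ?thesis unfolding inner_value_def by (intro exI[of _ 1]) auto
      next
        case False
        then have "3 < x M" using base k by simp
        then have "\<not> inner_value y K 3" using x1_inner not_both[of 3] k by auto
        then show ?thesis
          using inner_value_or_next[of K y 2] y_steps start finish \<open>3 < x M\<close> k by auto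
      qed
      with k show ?thesis by simp
    qed
  next
    case (step h)
    then show ?case
      using not_both[of h] inner_value_or_next[of M x h] inner_value_or_next[of K y h]
        x_steps y_steps start finish by auto
  qed
  have x_odd: "odd (x i)" if "0 < i" "i < M" for i
  proof (rule ccontr)
    assume "\<not> odd (x i)"
    moreover have "\<kappa> < x i" "x i < x M" using x_less[of 0 i] x_less[of i M] that start by auto
    ultimately have "inner_value y K (x i)" using inner[of "x i"] by simp
    then show False using not_both[of "x i"] that unfolding inner_value_def by blast
  qed
  have y_even: "even (y j)" if "0 < j" "j < K" for j
  proof (rule ccontr)
    assume "\<not> even (y j)"
    moreover have "\<kappa> < y j" "y j < x M"
      using y_less[of 0 j] y_less[of j K] that start finish by auto
    ultimately have "inner_value x M (y j)" using inner[of "y j"] by simp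
    then show False using not_both[of "y j"] that unfolding inner_value_def by blast
  qed
  have x_eq: "x i = 2 * (int i + \<kappa>) - 1" if "0 < i" "i < M" for i
    using that
  proof (induction i rule: nat_induct_non_zero)
    case 1
    then show ?case using start by simp
  next
    case (Suc i)
    then have "x i = 2 * (int i + \<kappa>) - 1" by simp
    with x_steps[of i] x_odd[of "Suc i"] Suc show ?case by auto
  qed
  have y_eq: "y j = 2 * int j" if "0 < j" "j < K" for j
    using that
  proof (induction j rule: nat_induct_non_zero)
    case 1
    then show ?case using start y_steps[of 0] y_even[of 1] \<kappa> by auto
  next
    case (Suc j)
    then have "y j = 2 * int j" by simp
    with y_steps[of j] y_even[of "Suc j"] Suc show ?case by auto
  qed
  have TM: "x M = 2 * int M + 2 * \<kappa> - 2 \<or> x M = 2 * int M + 2 * \<kappa> - 1"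
  proof (cases "M = 1")
    case True
    have "1 < K" using True size by simp
    then have "\<kappa> + 1 < x M" using y_less[of 0 1] y_less[of 1 K] start finish by auto
    with True start \<kappa> show ?thesis by auto
  next
    case False
    then show ?thesis using x_eq[of "M - 1"] x_steps[of "M - 1"] size by auto
  qed
  have TK: "x M = 2 * int K - 1 \<or> x M = 2 * int K"
  proof (cases "K = 1")
    case True
    then have "1 < M" using size by simp
    then have "2 * \<kappa> + 1 < x M" using x_less[of 1 M] start by simp
    with True y_steps[of 0] start \<kappa> finish show ?thesis by auto
  next
    case False
    then show ?thesis using y_eq[of "K - 1"] y_steps[of "K - 1"] size finish by auto
  qed
  have Mk: "2 \<le> int M + \<kappa>"
  proof (cases "M = 1")
    case True
    then have "1 < K" using size by simp
    then have "\<kappa> + 1 < x M" using y_less[of 0 1] y_less[of 1 K] start finish by auto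
    with True start \<kappa> show ?thesis by auto
  next
    case False
    then show ?thesis using size \<kappa> by auto
  qed
  define t where "t = nat (int M + \<kappa> - 2)"
  have t: "int M + \<kappa> = int t + 2" using Mk by (simp add: t_def)
  have ends: "K = t + 2 \<and> x M = 2 * int t + 3 \<or> K = t + 1 \<and> x M = 2 * int t + 2"
    using TM TK t by presburger
  have "x i = max \<kappa> (min (x M) (2 * (int i + \<kappa>) - 1))" if iM: "i \<le> M" for i
  proof -
    consider "i = 0" | "0 < i" "i < M" | "i = M" using iM by linarith
    then show ?thesis
    proof cases
      case 1
      then show ?thesis using start \<kappa> ends by auto
    next
      case 2
      then show ?thesis using x_eq[of i] x_less[of i M] \<kappa> by auto
    next
      case 3
      then show ?thesis using ends t \<kappa> by auto
    qed
  qed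
  moreover have "y j = max \<kappa> (min (x M) (2 * int j))" if jK: "j \<le> K" for j
  proof -
    consider "j = 0" | "0 < j" "j < K" | "j = K" using jK by linarith
    then show ?thesis
    proof cases
      case 1
      then show ?thesis using start \<kappa> ends by auto
    next
      case 2
      then show ?thesis using y_eq[of j] y_less[of j K] finish \<kappa> by auto
    next
      case 3
      then show ?thesis using ends finish \<kappa> by auto
    qed
  qed
  ultimately show ?thesis using t ends by blast
qed

section \<open>The four families as interval orders\<close>

text \<open>
  The flag \<open>p\<close> tells that the extra point \<open>x\<^sub>0\<close> exists, the flag
  \<open>q\<close> that \<open>a\<close> is \<open>y\<^bsub>t+1\<^esub>\<close>. One parametrized family
  replaces the four.
\<close>
definition family_points :: "bool \<Rightarrow> bool \<Rightarrow> nat \<Rightarrow> point set" where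
  "family_points p q t = core_points t \<union> (if q then {} else {PA}) \<union> (if p then {PX 0} else {})"

definition family_relations :: "bool \<Rightarrow> bool \<Rightarrow> nat \<Rightarrow> (point \<times> point) set" where
  "family_relations p q t =
     (if q then {} else {(PY (t + 1), PA)}) \<union> (if p then {(PB, PX 1)} else {})"

definition family_top :: "bool \<Rightarrow> nat \<Rightarrow> point" where
  "family_top q t = (if q then PY (t + 1) else PA)"

definition family_light :: "bool \<Rightarrow> bool \<Rightarrow> nat \<Rightarrow> point set" where
  "family_light p q t = {if p then PX 0 else PY 0, if q then PX (t + 1) else PY (t + 1)}"

definition family :: "bool \<Rightarrow> bool \<Rightarrow> nat \<Rightarrow> point weighted_poset set" where
  "family p q t = family_posets (family_top q t) (family_points p q t)
     (family_relations p q t) (family_light p q t)"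

lemma F_family:
  "F1 t = family False False t" "F2 t = family False True t"
  "F3 t = family True False t" "F4 t = family True True t"
  by (simp_all add: F1_def F2_def F3_def F4_def family_def family_points_def family_relations_def
      family_top_def family_light_def insert_commute)

lemma forbidden_family: "forbidden = three_plus_one \<union> (\<Union>p q t. family p q t)"
  unfolding forbidden_def F_family by (auto simp: UNIV_bool)

text \<open>
  A concrete interval representation of the generated order, lengths disregarded: \<open>x\<^sub>i\<close> is
  \<open>[4 i - 5, 4 i + 2]\<close> and \<open>y\<^sub>j\<close> is \<open>[4 j, 4 j + 1]\<close>.
  The flag only moves the single point of \<open>b\<close>, which touches the left end \<open>-1\<close> of
  \<open>x\<^sub>1\<close> or lies before it.
\<close>
fun left_end :: "bool \<Rightarrow> nat \<Rightarrow> point \<Rightarrow> int" where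
  "left_end p t (PX i) = 4 * int i - 5"
| "left_end p t (PY i) = 4 * int i"
| "left_end p t PA = 4 * int t + 6"
| "left_end p t PB = (if p then - 2 else - 1)"

fun right_end :: "bool \<Rightarrow> nat \<Rightarrow> point \<Rightarrow> int" where
  "right_end p t (PX i) = 4 * int i + 2"
| "right_end p t (PY i) = 4 * int i + 1"
| "right_end p t PA = 4 * int t + 6"
| "right_end p t PB = (if p then - 2 else - 1)"

abbreviation family_order :: "bool \<Rightarrow> bool \<Rightarrow> nat \<Rightarrow> point \<Rightarrow> point \<Rightarrow> bool" where
  "family_order p q t \<equiv> generated_order (family_points p q t) (family_relations p q t)"

lemma in_family_points [simp]:
  "PX i \<in> family_points p q t \<longleftrightarrow> i \<le> t + 1 \<and> (p \<or> 0 < i)"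
  "PY i \<in> family_points p q t \<longleftrightarrow> i \<le> t + 1"
  "PA \<in> family_points p q t \<longleftrightarrow> \<not> q"
  "PB \<in> family_points p q t"
  by (auto simp: family_points_def core_points_def)

lemma left_end_le_right_end: "left_end p t u \<le> right_end p t u"
  by (cases u) auto

lemma family_order_imp_left_of:
  assumes "family_order p q t u v"
  shows "u \<in> family_points p q t \<and> v \<in> family_points p q t \<and> right_end p t u < left_end p t v"
  using assms unfolding generated_order_def
proof (induction rule: trancl_induct)
  case (base v)
  then show ?case
    by (auto simp: common_comparabilities_def family_relations_def split: if_splits)
next
  case (step v z)
  then have "right_end p t v < left_end p t z" "z \<in> family_points p q t"
    by (auto simp: common_comparabilities_def family_relations_def split: if_splits)
  with step.IH left_end_le_right_end[of p t v] show ?case by simp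
qed

lemma family_order_step:
  assumes "(u, v) \<in> common_comparabilities \<union> family_relations p q t"
    "u \<in> family_points p q t" "v \<in> family_points p q t"
  shows "family_order p q t u v"
  using assms unfolding generated_order_def by blast

lemma family_order_trans:
  "family_order p q t u v \<Longrightarrow> family_order p q t v z \<Longrightarrow> family_order p q t u z"
  unfolding generated_order_def by (rule trancl_trans)

lemma family_order_YY:
  assumes "i < j" "j \<le> t + 1"
  shows "family_order p q t (PY i) (PY j)"
proof -
  from \<open>i < j\<close> have "Suc i \<le> j" by simp
  then show ?thesis using \<open>j \<le> t + 1\<close>
  proof (induction j rule: dec_induct)
    case base
    then show ?case by (intro family_order_step) (auto simp: common_comparabilities_def)
  next
    case (step j)
    have "family_order p q t (PY j) (PY (Suc j))"
      using step.prems by (intro family_order_step) (auto simp: common_comparabilities_def)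
    with step show ?case using family_order_trans by simp
  qed
qed

text \<open>
  Every relation between points that are far apart factors through the chain of the \<open>y\<^sub>j\<close>;
  the generating relations enter and leave this chain.
\<close>
lemma left_of_imp_family_order:
  assumes u: "u \<in> family_points p q t" and v: "v \<in> family_points p q t"
    and less: "right_end p t u < left_end p t v"
  shows "family_order p q t u v"
proof -
  let ?R = "family_order p q t"
  have XY: "?R (PX i) (PY (i + 1))" if "PX i \<in> family_points p q t" "i \<le> t" for i
    using that by (intro family_order_step) (auto simp: common_comparabilities_def)
  have YX: "?R (PY i) (PX (i + 2))" if "i + 1 \<le> t" for i
    using that by (intro family_order_step) (auto simp: common_comparabilities_def)
  have YA: "?R (PY i) PA" if "i \<le> t + 1" "\<not> q" for i
  proof -
    have "?R (PY (t + 1)) PA"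
      using that by (intro family_order_step) (auto simp: family_relations_def)
    then show ?thesis
      using that family_order_trans[OF family_order_YY[of i "t + 1" t p q]] by (cases "i = t + 1") auto
  qed
  have BY: "?R PB (PY i)" if "i \<le> t + 1" for i
  proof -
    have "?R PB (PY 0)"
      by (intro family_order_step) (auto simp: common_comparabilities_def)
    then show ?thesis
      using that family_order_trans[OF _ family_order_YY[of 0 i t p q]] by (cases "i = 0") auto
  qed
  have XYs: "?R (PX i) (PY j)" if "PX i \<in> family_points p q t" "i < j" "j \<le> t + 1" for i j
    using that XY[of i] family_order_trans[OF XY[of i] family_order_YY[of "i + 1" j t p q]]
    by (cases "j = i + 1") auto
  have YXs: "?R (PY i) (PX j)" if "i + 2 \<le> j" "j \<le> t + 1" for i j
  proof -
    obtain k where k: "j = k + 2" "i \<le> k"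
      using \<open>i + 2 \<le> j\<close> by (intro that[of "j - 2"]) auto
    then show ?thesis
      using that YX[of k] family_order_trans[OF family_order_YY[of i k t p q] YX[of k]]
      by (cases "k = i") auto
  qed
  show ?thesis
  proof (cases u)
    case uX: (PX i)
    show ?thesis
    proof (cases v)
      case (PX j)
      show ?thesis
      proof (cases "j = i + 2")
        case True
        with uX PX u v show ?thesis
          by (intro family_order_step) (auto simp: common_comparabilities_def)
      next
        case False
        with uX PX u v less show ?thesis
          using family_order_trans[OF XYs[of i "i + 1"] YXs[of "i + 1" j]] by auto
      qed
    next
      case (PY j)
      with uX u v less show ?thesis using XYs by auto
    next
      case PA
      with uX u v less show ?thesis
        using family_order_trans[OF XYs[of i "i + 1"] YA[of "i + 1"]] by auto
    next
      case PB
      with uX u v less show ?thesis by (auto split: if_splits)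
    qed
  next
    case uY: (PY i)
    with u v less show ?thesis
      using family_order_YY YXs YA by (cases v) (auto split: if_splits)
  next
    case PA
    with v less show ?thesis by (cases v) (auto split: if_splits)
  next
    case uB: PB
    show ?thesis
    proof (cases v)
      case (PX j)
      show ?thesis
      proof (cases "j \<le> 1")
        case True
        with uB PX less have "j = 1" "p" by (auto split: if_splits)
        with uB PX v show ?thesis
          by (intro family_order_step) (auto simp: family_relations_def)
      next
        case False
        then have "j - 2 + 2 \<le> j" by simp
        with uB PX v show ?thesis
          using family_order_trans[OF BY[of "j - 2"] YXs[of "j - 2" j]] by simp
      qed
    next
      case (PY j)
      with uB v show ?thesis using BY by auto
    next
      case PA
      with uB v show ?thesis using family_order_trans[OF BY[of 0] YA[of 0]] by simp
    next
      case PB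
      with uB less show ?thesis by (auto split: if_splits)
    qed
  qed
qed

lemma family_order_iff:
  "u \<in> family_points p q t \<Longrightarrow> v \<in> family_points p q t \<Longrightarrow>
     family_order p q t u v \<longleftrightarrow> right_end p t u < left_end p t v"
  using family_order_imp_left_of left_of_imp_family_order by blast

section \<open>Forbidden posets have no representation\<close>

text \<open>
  Both chains are measured on the scale of \<open>interleave\<close>, on which \<open>b\<close> ends at
  \<open>\<kappa>\<close>: the left end of \<open>y\<^sub>j\<close> is larger than \<open>2 j\<close>, and that
  of \<open>x\<^sub>i\<close> at most \<open>2 i - 1\<close>, both truncated below at
  \<open>\<kappa>\<close>. At the point \<open>a\<close> the two bounds contradict each other.
\<close>
lemma family_not_representable:
  fixes L :: "point \<Rightarrow> real"
  assumes Q: "(S, R, g) \<in> family p q t"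
    and L: "\<And>u v. u \<in> S \<Longrightarrow> v \<in> S \<Longrightarrow> R u v \<longleftrightarrow> L u + g u < L v"
  shows False
proof -
  have S: "S = family_points p q t" and R: "R = family_order p q t"
    and g: "\<And>v. v \<in> S \<Longrightarrow> v \<noteq> family_top q t \<Longrightarrow> v \<noteq> PB \<Longrightarrow>
      g v = (if v \<in> family_light p q t then 1 else 2)"
    using Q by (auto simp: family_def family_posets_def)
  have rel: "L u + g u < L v \<longleftrightarrow> right_end p t u < left_end p t v" if "u \<in> S" "v \<in> S" for u v
    using L[OF that] family_order_iff[of u p q t v] that by (simp add: S R)
  define \<kappa> :: real where "\<kappa> = (if p then 0 else 1)"
  define B where "B = L PB + g PB - \<kappa>"
  \<comment> \<open>The maximum with \<open>\<kappa>\<close> accounts for the weight 1 of \<open>y\<^sub>0\<close> when \<open>x\<^sub>0\<close> is missing.\<close>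
  have low: "B + max \<kappa> (2 * real j) < L (PY j)" if "j \<le> t + 1" for j
    using that
  proof (induction j)
    case 0
    then show ?case using rel[of PB "PY 0"] by (simp add: S B_def \<kappa>_def)
  next
    case (Suc j)
    have "L (PY j) + g (PY j) < L (PY (Suc j))"
      using rel[of "PY j" "PY (Suc j)"] Suc.prems by (simp add: S)
    moreover have "g (PY j) = (if j = 0 \<and> \<not> p then 1 else 2)"
      using g[of "PY j"] Suc.prems by (auto simp: S family_top_def family_light_def)
    ultimately show ?case using Suc by (auto simp: \<kappa>_def split: if_splits)
  qed
  have high: "L (PX i) \<le> B + max \<kappa> (2 * real i - 1)" if "PX i \<in> S" for i
    using that
  proof (induction i)
    case 0
    then show ?case using rel[of PB "PX 0"] by (auto simp: S B_def \<kappa>_def)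
  next
    case (Suc i)
    show ?case
    proof (cases "i = 0 \<and> \<not> p")
      case True
      with Suc.prems show ?thesis
        using rel[of PB "PX 1"] by (auto simp: S B_def \<kappa>_def)
    next
      case False
      with Suc.prems have i: "PX i \<in> S" by (auto simp: S)
      have "L (PX (Suc i)) \<le> L (PX i) + g (PX i)"
        using rel[OF i Suc.prems] by simp
      moreover have "g (PX i) = (if i = 0 then 1 else 2)"
        using g[OF i] Suc.prems False by (auto simp: S family_top_def family_light_def)
      ultimately show ?thesis using Suc.IH[OF i] False by (auto simp: \<kappa>_def split: if_splits)
    qed
  qed
  have last: "L (PX (t + 1)) \<le> B + 2 * real t + 1" using high[of "t + 1"]
    by (auto simp: S \<kappa>_def)
  have gX: "g (PX (t + 1)) = (if q then 1 else 2)"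
    using g[of "PX (t + 1)"] by (auto simp: S family_top_def family_light_def)
  show False
  proof (cases q)
    case True
    have "L (PY (t + 1)) \<le> L (PX (t + 1)) + g (PX (t + 1))"
      using rel[of "PX (t + 1)" "PY (t + 1)"] by (simp add: S)
    with low[of "t + 1"] last gX True show False by (auto simp: \<kappa>_def)
  next
    case False
    have "L PA \<le> L (PX (t + 1)) + g (PX (t + 1))"
      using rel[of "PX (t + 1)" PA] False by (simp add: S)
    moreover have "L (PY (t + 1)) + g (PY (t + 1)) < L PA"
      using rel[of "PY (t + 1)" PA] False by (simp add: S)
    moreover have "g (PY (t + 1)) = 1"
      using g[of "PY (t + 1)"] False by (auto simp: S family_top_def family_light_def)
    ultimately show False using low[of "t + 1"] last gX False by (auto simp: \<kappa>_def)
  qed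
qed

lemma three_plus_one_not_representable:
  fixes L :: "point \<Rightarrow> real"
  assumes Q: "(S, R, g) \<in> three_plus_one"
    and L: "\<And>u v. u \<in> S \<Longrightarrow> v \<in> S \<Longrightarrow> R u v \<longleftrightarrow> L u + g u < L v"
  shows False
proof -
  have S: "S = {PA, PY 0, PB, PX 0}"
    and R: "R = (\<lambda>u v. (u, v) \<in> {(PB, PY 0), (PY 0, PA), (PB, PA)})"
    and g: "g (PY 0) \<in> {1, 2}" "g (PX 0) \<in> {1, 2}" "g (PY 0) = 2 \<or> g (PX 0) = 1"
    using Q unfolding three_plus_one_def by auto
  have "L PB + g PB < L (PY 0)" using L[of PB "PY 0"] by (simp add: S R)
  moreover have "L (PY 0) + g (PY 0) < L PA" using L[of "PY 0" PA] by (simp add: S R)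
  moreover have "L (PX 0) \<le> L PB + g PB" using L[of PB "PX 0"] by (simp add: S R)
  moreover have "L PA \<le> L (PX 0) + g (PX 0)" using L[of "PX 0" PA] by (simp add: S R)
  ultimately have "g (PY 0) < g (PX 0)" by linarith
  with g show False by auto
qed

lemma forbidden_not_representable:
  fixes L :: "point \<Rightarrow> real"
  assumes "(S, R, g) \<in> forbidden"
    and "\<And>u v. u \<in> S \<Longrightarrow> v \<in> S \<Longrightarrow> R u v \<longleftrightarrow> L u + g u < L v"
  shows False
  using assms(1) unfolding forbidden_family
proof
  assume "(S, R, g) \<in> three_plus_one"
  from three_plus_one_not_representable[OF this assms(2)] show False .
next
  assume "(S, R, g) \<in> (\<Union>p q t. family p q t)"
  then obtain p q t where "(S, R, g) \<in> family p q t" by blast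
  from family_not_representable[OF this assms(2)] show False .
qed

section \<open>Closed walks in a weighted interval order\<close>

lemma completely_left_intervals:
  assumes "a \<le> b" "c \<le> d"
  shows "completely_left {a..b} {c..d} \<longleftrightarrow> b < c"
proof
  assume "completely_left {a..b} {c..d}"
  moreover have "b \<in> {a..b}" "c \<in> {c..d}" using assms by simp_all
  ultimately show "b < c" unfolding completely_left_def by blast
next
  assume "b < c"
  then show "completely_left {a..b} {c..d}"
    unfolding completely_left_def by (meson atLeastAtMost_iff le_less_trans less_le_trans)
qed

text \<open>Weights are integers here, so that weights of walks can be compared exactly.\<close>
locale weighted_interval_order =
  fixes X :: "'a set" and prec :: "'a \<Rightarrow> 'a \<Rightarrow> bool" and c :: "'a \<Rightarrow> int"
  assumes interval_order: "interval_order X prec"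
    and weight: "x \<in> X \<Longrightarrow> c x \<in> {1, 2}"
begin

lemma irrefl: "x \<in> X \<Longrightarrow> \<not> prec x x"
  using interval_order unfolding interval_order_def poset_def by (auto dest: irreflp_onD)

lemma trans: "prec x y \<Longrightarrow> prec y z \<Longrightarrow> x \<in> X \<Longrightarrow> y \<in> X \<Longrightarrow> z \<in> X \<Longrightarrow> prec x z"
  using interval_order unfolding interval_order_def poset_def by (auto dest: transp_onD)

lemma asym: "prec x y \<Longrightarrow> x \<in> X \<Longrightarrow> y \<in> X \<Longrightarrow> \<not> prec y x"
  using irrefl trans by blast

text \<open>
  If \<open>a\<close> ends before \<open>b\<close> begins and \<open>x\<close> before \<open>y\<close> begins,
  then the one of \<open>a\<close> and \<open>x\<close> that ends first does so before both \<open>b\<close> and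
  \<open>y\<close> begin.
\<close>
lemma no_two_plus_two:
  assumes "prec a b" "prec x y" "a \<in> X" "b \<in> X" "x \<in> X" "y \<in> X"
  shows "prec a y \<or> prec x b"
proof -
  obtain I where I: "\<forall>v\<in>X. \<exists>l r. l \<le> r \<and> I v = {l..r::real}"
    "\<forall>x\<in>X. \<forall>y\<in>X. prec x y \<longleftrightarrow> completely_left (I x) (I y)"
    using interval_order unfolding interval_order_def interval_representation_def by blast
  then obtain l r where lr: "\<And>v. v \<in> X \<Longrightarrow> l v \<le> r v" "\<And>v. v \<in> X \<Longrightarrow> I v = {l v..r v}"
    by metis
  have "prec x y \<longleftrightarrow> r x < l y" if "x \<in> X" "y \<in> X" for x y
    using I(2) that lr completely_left_intervals[of "l x" "r x" "l y" "r y"] by simp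
  then show ?thesis
    using assms lr(1) by (meson less_le_trans less_trans not_less)
qed

definition arc :: "'a \<Rightarrow> 'a \<Rightarrow> bool" where
  "arc x y \<longleftrightarrow> x \<in> X \<and> y \<in> X \<and> (prec y x \<or> incomparable prec x y)"

text \<open>The weight of an arc of the digraph without the \<open>\<epsilon>\<close> term.\<close>
definition wt :: "'a \<Rightarrow> 'a \<Rightarrow> int" where
  "wt x y = (if prec y x then - c y else c x)"

text \<open>
  If all inequalities along the walk were tight, \<open>level v i\<close> would be the left endpoint of
  \<open>v i\<close>, relative to that of \<open>v 0\<close>.
\<close>
definition level :: "(nat \<Rightarrow> 'a) \<Rightarrow> nat \<Rightarrow> int" where
  "level v i = (\<Sum>k<i. wt (v k) (v (Suc k)))"

text \<open>
  A closed walk of \<open>n\<close> steps is an \<open>n\<close>-periodic sequence, which makes all rotations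
  available by shifting the index. Vertices may repeat.
\<close>
definition closed_walk :: "nat \<Rightarrow> (nat \<Rightarrow> 'a) \<Rightarrow> bool" where
  "closed_walk n v \<longleftrightarrow> 0 < n \<and> (\<forall>i. v (i + n) = v i) \<and> (\<forall>i. arc (v i) (v (Suc i)))"

definition bad_walk :: "nat \<Rightarrow> (nat \<Rightarrow> 'a) \<Rightarrow> bool" where
  "bad_walk n v \<longleftrightarrow> closed_walk n v \<and> level v n \<le> 0"

definition shortest_bad_walk :: "nat \<Rightarrow> (nat \<Rightarrow> 'a) \<Rightarrow> bool" where
  "shortest_bad_walk n v \<longleftrightarrow> bad_walk n v \<and> (\<forall>m u. bad_walk m u \<longrightarrow> n \<le> m)"

lemma arc_in: "arc x y \<Longrightarrow> x \<in> X" "arc x y \<Longrightarrow> y \<in> X"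
  by (auto simp: arc_def)

lemma wt_le: "x \<in> X \<Longrightarrow> y \<in> X \<Longrightarrow> wt x y \<le> c x"
  using weight[of x] weight[of y] by (auto simp: wt_def)

lemma level_Suc: "level v (Suc i) = level v i + wt (v i) (v (Suc i))"
  by (simp add: level_def)

lemma level_0 [simp]: "level v 0 = 0"
  by (simp add: level_def)

lemma level_shift: "level (\<lambda>k. v (k + i)) k = level v (k + i) - level v i"
  by (induction k) (simp_all add: level_Suc)

lemma closed_walk_shift: "closed_walk n v \<Longrightarrow> closed_walk n (\<lambda>k. v (k + i))"
  by (simp add: closed_walk_def) (metis add.commute add.left_commute)

lemma level_period:
  assumes "closed_walk n v"
  shows "level v (i + n) = level v i + level v n"
proof (induction i)
  case (Suc i)
  have "v (i + n) = v i" "v (Suc (i + n)) = v (Suc i)"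
    using assms unfolding closed_walk_def by (simp, metis add_Suc)
  with Suc show ?case by (simp add: level_Suc)
qed simp

lemma bad_walk_shift: "bad_walk n v \<Longrightarrow> bad_walk n (\<lambda>k. v (k + i))"
  using level_period[of n v i]
  by (auto simp: bad_walk_def closed_walk_shift level_shift add.commute[of n])

lemma shortest_bad_walk_shift:
  "shortest_bad_walk n v \<Longrightarrow> shortest_bad_walk n (\<lambda>k. v (k + i))"
  by (simp add: shortest_bad_walk_def bad_walk_shift)

text \<open>A chord back to the start of a segment turns the segment into a closed walk.\<close>
lemma close_segment:
  assumes v: "closed_walk n v" and "arc (v (i + d)) (v i)"
  shows "\<exists>u. closed_walk (Suc d) u \<and>
    level u (Suc d) = level v (i + d) - level v i + wt (v (i + d)) (v i)"
proof -
  define u where "u k = v (i + k mod Suc d)" for k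
  have step: "arc (u k) (u (Suc k))" for k
  proof (cases "k mod Suc d = d")
    case True
    then have "Suc k mod Suc d = 0" by (simp add: mod_Suc)
    with True assms(2) show ?thesis by (simp add: u_def)
  next
    case False
    then have "Suc k mod Suc d = Suc (k mod Suc d)" by (simp add: mod_Suc)
    with v show ?thesis by (simp add: u_def closed_walk_def)
  qed
  have lev: "level u k = level v (i + k) - level v i" if "k \<le> d" for k
    using that
  proof (induction k)
    case (Suc k)
    then have "u k = v (i + k)" "u (Suc k) = v (i + Suc k)" by (simp_all add: u_def)
    with Suc show ?case by (simp add: level_Suc)
  qed simp
  have "closed_walk (Suc d) u"
  proof -
    have "u (k + Suc d) = u k" for k unfolding u_def by (simp only: mod_add_self2)
    with step show ?thesis by (simp add: closed_walk_def)
  qed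
  moreover have "level u (Suc d) = level v (i + d) - level v i + wt (v (i + d)) (v i)"
    using lev[of d] by (simp add: level_Suc) (simp add: u_def)
  ultimately show ?thesis by blast
qed

lemma close_segment_eq:
  assumes v: "closed_walk n v" and "v (i + d) = v i" "0 < d"
  shows "\<exists>u. closed_walk d u \<and> level u d = level v (i + d) - level v i"
proof -
  obtain e where e: "d = Suc e" using \<open>0 < d\<close> by (cases d) auto
  have "arc (v (i + e)) (v (Suc (i + e)))" using v by (simp add: closed_walk_def)
  then have "arc (v (i + e)) (v i)" using assms(2) e by simp
  from close_segment[OF v this] show ?thesis
    using assms(2) e by (auto simp: level_Suc)
qed

end

section \<open>Shortest bad walks\<close>

locale shortest_walk = weighted_interval_order +
  fixes n :: nat and v :: "nat \<Rightarrow> 'a"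
  assumes shortest: "shortest_bad_walk n v"
begin

abbreviation P :: "nat \<Rightarrow> int" where "P \<equiv> level v"

abbreviation w :: "nat \<Rightarrow> int" where "w i \<equiv> c (v i)"

text \<open>The drop in level over one period.\<close>
definition \<delta> :: int where "\<delta> = - P n"

definition down :: "nat \<Rightarrow> bool" where "down i \<longleftrightarrow> prec (v (Suc i)) (v i)"

lemma closed: "closed_walk n v" and \<delta>_nonneg: "0 \<le> \<delta>"
  using shortest by (auto simp: shortest_bad_walk_def bad_walk_def \<delta>_def)

lemma n_pos: "0 < n" and v_period [simp]: "v (i + n) = v i" and arc_step: "arc (v i) (v (Suc i))"
  using closed by (auto simp: closed_walk_def)

lemma v_in [simp]: "v i \<in> X"
  using arc_step by (rule arc_in)

lemma w12: "w i = 1 \<or> w i = 2"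
  using weight[of "v i"] by auto

lemma P_period: "P (i + n) = P i - \<delta>"
  using level_period[OF closed] by (simp add: \<delta>_def)

lemma down_period [simp]: "down (i + n) = down i"
  using v_period[of "Suc i"] by (simp add: down_def)

lemma P_down: "down i \<Longrightarrow> P (Suc i) = P i - w (Suc i)"
  by (simp add: level_Suc wt_def down_def)

lemma P_up: "\<not> down i \<Longrightarrow> P (Suc i) = P i + w i"
  by (simp add: level_Suc wt_def down_def)

lemma up_incomparable: "\<not> down i \<Longrightarrow> incomparable prec (v i) (v (Suc i))"
  using arc_step[of i] by (auto simp: arc_def down_def)

lemma up_not_prec: "\<not> down i \<Longrightarrow> \<not> prec (v i) (v (Suc i))" "\<not> down i \<Longrightarrow> \<not> prec (v (Suc i)) (v i)"
  using up_incomparable[of i] by (auto simp: incomparable_def)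

lemma shorter_positive: "closed_walk m u \<Longrightarrow> m < n \<Longrightarrow> 0 < level u m"
  using shortest by (force simp: shortest_bad_walk_def bad_walk_def)

lemma chord:
  assumes "arc (v (i + d)) (v i)" "d + 2 \<le> n"
  shows "0 < P (i + d) - P i + wt (v (i + d)) (v i)"
  using close_segment[OF closed assms(1)] shorter_positive[of "Suc d"] assms(2) by force

text \<open>
  A repeated vertex splits the walk into two shorter closed walks. Both have positive weight, but the sum is the
  weight of the whole.
\<close>
lemma distinct_step:
  assumes "0 < d" "d < n"
  shows "v (i + d) \<noteq> v i"
proof
  assume eq: "v (i + d) = v i"
  have 1: "0 < P (i + d) - P i"
    using close_segment_eq[OF closed eq] shorter_positive[of d] assms by force
  have "v ((i + d) + (n - d)) = v (i + d)" using eq assms v_period[of i] by (simp del: v_period)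
  then have "0 < P (i + n) - P (i + d)"
    using close_segment_eq[OF closed, of "i + d" "n - d"] shorter_positive[of "n - d"] assms
    by force
  with 1 show False using P_period[of i] \<delta>_nonneg by simp
qed

text \<open>
  One of the two arcs between \<open>v i\<close> and \<open>v (i + d)\<close> exists. Either closes one of
  the two parts of the walk, and the positive weight of the resulting closed walk is the stated inequality. In
  particular the left end of \<open>v (i + d)\<close> avoids the right end of \<open>v i\<close> and the
  \<open>\<delta>\<close> integers below it.
\<close>
lemma level_gap:
  assumes "2 \<le> d" "d + 2 \<le> n"
  shows "if prec (v i) (v (i + d)) then P i + w i < P (i + d) else P (i + d) < P i + w i - \<delta>"
proof (cases "prec (v i) (v (i + d))")
  case True
  then have "arc (v (i + d)) (v i)" by (simp add: arc_def)
  from chord[OF this assms(2)] True show ?thesis by (simp add: wt_def)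
next
  case False
  have "v (i + d) \<noteq> v i" using distinct_step assms by simp
  then have "arc (v i) (v (i + d))" using False by (auto simp: arc_def incomparable_def)
  \<comment> \<open>The chord to \<open>v (i + d)\<close> starts at \<open>v i\<close> one period later.\<close>
  then have "arc (v ((i + d) + (n - d))) (v (i + d))" using assms by simp
  from chord[OF this] have "0 < P (i + n) - P (i + d) + wt (v i) (v (i + d))"
    using assms by simp
  moreover have "wt (v i) (v (i + d)) \<le> w i" by (simp add: wt_le)
  ultimately show ?thesis using False P_period[of i] by simp
qed

corollary level_gap_avoids:
  assumes "2 \<le> d" "d + 2 \<le> n"
  shows "P (i + d) < P i + w i - \<delta> \<or> P i + w i < P (i + d)"
  using level_gap[OF assms, of i] by (auto split: if_splits)

lemma ex_down: "\<exists>i<n. down i"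
proof (rule ccontr)
  assume *: "\<not> ?thesis"
  have "P i \<ge> int i" if "i \<le> n" for i
    using that
  proof (induction i)
    case (Suc i)
    then show ?case using P_up[of i] w12[of i] * by auto
  qed simp
  then have "P n \<ge> int n" by simp
  then show False using n_pos \<delta>_nonneg by (simp add: \<delta>_def)
qed

lemma down_run:
  assumes "i < j" "\<And>k. i \<le> k \<Longrightarrow> k < j \<Longrightarrow> down k"
  shows "prec (v j) (v i)"
proof -
  have "prec (v (i + Suc d)) (v i)" if "i + d < j" for d
    using that
  proof (induction d)
    case 0
    then show ?case using assms(2)[of i] by (simp add: down_def)
  next
    case (Suc d)
    have "prec (v (Suc (i + Suc d))) (v (i + Suc d))"
      using assms(2)[of "i + Suc d"] Suc.prems by (simp add: down_def)
    with Suc show ?case using trans[of "v (Suc (i + Suc d))" "v (i + Suc d)" "v i"] by simp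
  qed
  from this[of "j - i - 1"] assms(1) show ?thesis by simp
qed

lemma ex_up: "\<exists>i<n. \<not> down i"
  using down_run[of 0 n] n_pos v_period[of 0] irrefl[of "v 0"] by force

end

context shortest_walk
begin

abbreviation valley :: "nat \<Rightarrow> bool" where "valley i \<equiv> down i \<and> \<not> down (Suc i)"

lemma down_periods [simp]: "down (i + k * n) = down i"
  by (induction k) (simp_all add: add.assoc[symmetric] add.commute[of n])

lemma P_periods: "P (i + k * n) = P i - int k * \<delta>"
proof (induction k)
  case (Suc k)
  then show ?case using P_period[of "i + k * n"] by (simp add: algebra_simps)
qed simp

text \<open>
  A valley is a descending step followed by an ascending one; its point \<open>v (Suc i)\<close> has right end
  \<open>P i\<close>. Levels do not increase from one period to the next, so that a valley that is highest
  within one period is at least as high as all later ones.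
\<close>
lemma highest_valley: "\<exists>i. valley i \<and> (\<forall>j\<ge>i. valley j \<longrightarrow> P j \<le> P i)"
proof -
  have val_mod: "valley (i mod n) \<longleftrightarrow> valley i" for i
    using down_periods[of "i mod n" "i div n"] down_periods[of "Suc (i mod n)" "i div n"] by simp
  have P_mod: "P i \<le> P (i mod n)" for i
    using P_periods[of "i mod n" "i div n"] \<delta>_nonneg by simp
  define S where "S = {i. i < n \<and> valley i}"
  obtain i where "i < n" "down i" using ex_down by blast
  obtain j where "j < n" "\<not> down j" using ex_up by blast
  obtain k where "valley k"
  proof (rule ccontr)
    assume *: "\<not> thesis"
    have "down (i + d)" for d
      by (induction d) (use * \<open>down i\<close> that in auto)
    from this[of "j + n - i"] \<open>i < n\<close> \<open>\<not> down j\<close> show False by simp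
  qed
  then have "k mod n \<in> S" using val_mod[of k] n_pos by (simp add: S_def)
  moreover have "finite S" by (simp add: S_def)
  ultimately have "Max (P ` S) \<in> P ` S" by (intro Max_in) auto
  then obtain i where i: "i \<in> S" "P i = Max (P ` S)" by force
  have "P j \<le> P i" if "valley j" for j
  proof -
    have "j mod n \<in> S" using val_mod[of j] that n_pos by (simp add: S_def)
    then have "P (j mod n) \<le> P i" using i \<open>finite S\<close> by simp
    with P_mod[of j] show ?thesis by simp
  qed
  with i(1) show ?thesis unfolding S_def by blast
qed

end

section \<open>A shortest bad walk has one ascent and one descent\<close>

text \<open>
  The walk is rotated such that \<open>v 0\<close> is the point of a highest valley. It becomes the point
  \<open>b\<close> of the forbidden poset, and \<open>P 1\<close> is its right end.
\<close>
locale valley_walk = shortest_walk +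
  assumes up_0: "\<not> down 0"
    and down_last: "down (n - 1)"
    and highest: "down k \<Longrightarrow> \<not> down (Suc k) \<Longrightarrow> P k \<le> P 1"
begin

lemma v_n [simp]: "v n = v 0"
  using v_period[of 0] by simp

lemma P_n: "P n = - \<delta>"
  by (simp add: \<delta>_def)

lemma P_1: "P 1 = w 0"
  using P_up[OF up_0] by simp

lemma P_last: "P (n - 1) = P 1 - \<delta>"
  using P_down[OF down_last] n_pos P_n P_1 by simp

text \<open>
  If the ascent from \<open>v 0\<close> had one arc only, then \<open>v 2 \<prec> v 1\<close> and
  \<open>v 0 \<prec> v (n - 1)\<close> would give \<open>v 2 \<prec> v (n - 1)\<close>, as there is
  no \<open>2 + 2\<close>. The three arcs from \<open>v (n - 1)\<close> to \<open>v 2\<close> weigh as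
  much as this one, so the walk could be shortened.
\<close>
lemma up_1: "\<not> down 1"
proof
  assume d1: "down 1"
  have 0: "prec (v 0) (v (n - 1))" using down_last n_pos by (simp add: down_def)
  have 1: "prec (v 2) (v 1)" using d1 by (simp add: down_def numeral_2_eq_2)
  have 01: "\<not> prec (v 0) (v 1)" using up_not_prec[OF up_0] by simp
  have arc: "prec (v 2) (v (n - 1))"
    using no_two_plus_two[OF 0 1] 01 by simp
  consider "n = 1" | "n = 2" | "n = 3" | "4 \<le> n" using n_pos by linarith
  then show False
  proof cases
    assume "n = 1"
    with up_0 down_last show False by simp
  next
    assume "n = 2"
    with 0 01 show False by simp
  next
    assume "n = 3"
    with arc irrefl[of "v 2"] show False by simp
  next
    assume n: "4 \<le> n"
    have eq: "2 + (n - 3) = n - 1" using n by simp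
    have "arc (v (n - 1)) (v 2)" using arc by (simp add: arc_def)
    then have "0 < P (n - 1) - P 2 + wt (v (n - 1)) (v 2)"
      using chord[of 2 "n - 3"] n unfolding eq by simp
    then have "0 < P (n - 1) - P 2 - w 2" using arc by (simp add: wt_def)
    moreover have "P 2 = P 1 - w 2" using P_down[OF d1] by (simp add: numeral_2_eq_2)
    ultimately show False using P_last \<delta>_nonneg by simp
  qed
qed

lemma P_2: "P 2 = P 1 + w 1"
  using P_up[OF up_1] by (simp add: numeral_2_eq_2)

lemma n_ge_3: "3 \<le> n"
proof (rule ccontr)
  assume "\<not> 3 \<le> n"
  then have "n = 1 \<or> n = 2" using n_pos by linarith
  then show False using up_0 up_1 down_last by auto
qed

text \<open>
  The argument for \<open>v (n - 2)\<close> mirrors the one for \<open>v 2\<close>: the arcs from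
  \<open>v (n - 2)\<close> to \<open>v 1\<close> could be replaced by a single one.
\<close>
lemma n_ge_4: "4 \<le> n" and down_penultimate: "down (n - 2)"
proof -
  have n3: "n \<noteq> 3"
  proof
    assume n: "n = 3"
    then have "P 2 = P 1 - \<delta>" using P_last by simp
    then show False using P_2 w12[of 1] \<delta>_nonneg by simp
  qed
  then show n: "4 \<le> n" using n_ge_3 by simp
  show "down (n - 2)"
  proof (rule ccontr)
    assume up: "\<not> down (n - 2)"
    have Suc: "Suc (n - 2) = n - 1" using n by simp
    have 0: "prec (v 0) (v (n - 1))" using down_last n_pos by (simp add: down_def)
    have 01: "\<not> prec (v 0) (v 1)" using up_not_prec[OF up_0] by simp
    have 2: "\<not> prec (v (n - 2)) (v (n - 1))" using up_not_prec[OF up] Suc by simp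
    have "\<not> prec (v (n - 2)) (v 1)"
      using no_two_plus_two[OF 0, of "v (n - 2)" "v 1"] 01 2 v_in by blast
    moreover have eq: "1 + (n - 3) = n - 2" using n by simp
    moreover have "v (n - 2) \<noteq> v 1"
      using distinct_step[of "n - 3" 1] n eq by simp
    ultimately have "arc (v (n - 2)) (v 1)" by (auto simp: arc_def incomparable_def)
    then have "0 < P (n - 2) - P 1 + wt (v (n - 2)) (v 1)"
      using chord[of 1 "n - 3"] n eq by simp
    moreover have "wt (v (n - 2)) (v 1) \<le> w (n - 2)" by (simp add: wt_le)
    moreover have "P (n - 1) = P (n - 2) + w (n - 2)" using P_up[OF up] Suc by simp
    ultimately show False using P_last \<delta>_nonneg by simp
  qed
qed

text \<open>
  By \<open>level_gap\<close> the levels avoid \<open>P 1\<close> and the \<open>\<delta>\<close> integers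
  below it, so the walk can only jump over them. As steps have size at most 2, this takes
  \<open>\<delta> = 0\<close> and a step from \<open>P 1 + 1\<close> to \<open>P 1 - 1\<close>. After
  such a jump down, the walk also jumps back up, since it arrives at \<open>v (n - 1)\<close> from above. The
  point before the jump down has its left end at \<open>P 1 + 1\<close>, and the point before the jump up has
  its right end there. The two ends may meet only if the points are consecutive; then both jumps share their
  lower point, which is a valley higher than \<open>v 0\<close>.
\<close>
lemma above_root:
  assumes "2 \<le> j" "j + 2 \<le> n"
  shows "P 1 < P j"
proof (rule ccontr)
  assume "\<not> P 1 < P j"
  have avoid: "P k < P 1 - \<delta> \<or> P 1 < P k" if "2 \<le> k" "k + 2 \<le> n" for k
    using level_gap_avoids[of k 0] that P_1 by simp
  have P2: "P 1 < P 2" using P_2 w12[of 1] by auto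
  from int_crossing_down[of 2 j "P 1" P] \<open>\<not> P 1 < P j\<close> P2 assms
  obtain k where k: "2 \<le> k" "k < j" "P 1 < P k" "P (Suc k) \<le> P 1" by auto
  have dk: "down k" using k P_up[of k] w12[of k] by force
  have "P (Suc k) < P 1 - \<delta>" using avoid[of "Suc k"] k assms by simp
  then have d0: "\<delta> = 0" and Pk: "P k = P 1 + 1" and PSk: "P (Suc k) = P 1 - 1"
    using P_down[OF dk] w12[of "Suc k"] \<delta>_nonneg k by auto
  have "P (n - 1) = P (n - 2) - w (n - 1)"
    using P_down[OF down_penultimate] n_ge_4 by (simp add: Suc_diff_Suc numeral_2_eq_2)
  then have "P 1 < P (n - 2)" using avoid[of "n - 2"] n_ge_4 P_last w12[of "n - 1"] d0 by auto
  moreover have "Suc k \<le> n - 2" "P (Suc k) \<le> P 1" using k assms by simp_all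
  ultimately obtain l where l: "Suc k \<le> l" "l < n - 2" "P l \<le> P 1" "P 1 < P (Suc l)"
    using int_crossing_up[of "Suc k" "n - 2" P "P 1"] by blast
  have ul: "\<not> down l" using l P_down[of l] w12[of "Suc l"] by force
  have "P l < P 1" using avoid[of l] l k d0 by simp
  then have Pl: "P l = P 1 - 1" and wl: "w l = 2" using P_up[OF ul] w12[of l] l by auto
  show False
  proof (cases "l = Suc k")
    case True
    with ul dk highest[of k] Pk show False by simp
  next
    case False
    \<comment> \<open>The level of \<open>v k\<close> is read one period later, where it is the same because of \<open>\<delta> = 0\<close>.\<close>
    then have "P (l + (n + k - l)) < P l + w l - \<delta> \<or> P l + w l < P (l + (n + k - l))"
      using l k by (intro level_gap_avoids) auto
    moreover have "P (l + (n + k - l)) = P k" using P_period[of k] d0 l by (simp add: add.commute)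
    ultimately show False using Pk Pl wl d0 by simp
  qed
qed

text \<open>
  Another valley would have its right end above \<open>P 1\<close>, which contradicts the choice of
  \<open>v 0\<close>.
\<close>
lemma single_run: "\<exists>m. 1 \<le> m \<and> m + 3 \<le> n \<and> (\<forall>k<n. down k \<longleftrightarrow> m < k)"
proof -
  have no_valley: "down (Suc k)" if "down k" "Suc k < n" for k
  proof (rule ccontr)
    assume "\<not> down (Suc k)"
    with that highest have "P k \<le> P 1" by blast
    moreover have "2 \<le> k"
      using that up_0 up_1 by (metis One_nat_def less_2_cases not_less)
    moreover have "k + 2 \<noteq> n" "Suc k \<noteq> n - 1" using \<open>\<not> down (Suc k)\<close> down_last that by auto
    ultimately show False using above_root[of k] that by simp
  qed
  define m where "m = (LEAST k. down k) - 1"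
  have L: "down (LEAST k. down k)" using down_last by (rule LeastI)
  have "(LEAST k. down k) \<noteq> 0" "(LEAST k. down k) \<noteq> 1" using L up_0 up_1 by metis+
  then have m: "Suc m = (LEAST k. down k)" "1 \<le> m" by (simp_all add: m_def)
  have "(LEAST k. down k) \<le> n - 2" using down_penultimate by (rule Least_le)
  then have "m + 3 \<le> n" using m n_ge_4 by simp
  moreover have "down k" if "m < k" "k < n" for k
  proof -
    from that have "Suc m \<le> k" by simp
    then show ?thesis using \<open>k < n\<close>
    proof (induction k rule: dec_induct)
      case base
      then show ?case using L m by simp
    next
      case (step k)
      then show ?case using no_valley by simp
    qed
  qed
  moreover have "\<not> down k" if "k \<le> m" for k
    using that m not_less_Least[of k down] by simp
  ultimately show ?thesis using m(2) by (metis not_less)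
qed

end

context shortest_walk
begin

lemma ex_valley_walk: "\<exists>u. valley_walk X prec c n u"
proof -
  obtain i where i: "valley i" "\<And>j. i \<le> j \<Longrightarrow> valley j \<Longrightarrow> P j \<le> P i"
    using highest_valley by blast
  define u where "u k = v (k + Suc i)" for k
  interpret u: shortest_walk X prec c n u
    using shortest_bad_walk_shift[OF shortest, of "Suc i"] by unfold_locales (simp add: u_def[abs_def])
  have Pu: "level u k = P (k + Suc i) - P (Suc i)" for k
    unfolding u_def[abs_def] by (rule level_shift)
  have du: "u.down k = down (k + Suc i)" for k
    by (simp add: u.down_def down_def u_def)
  have "P (Suc (Suc i)) = P i" using P_up[of "Suc i"] P_down[of i] i(1) by simp
  moreover have "down (n - 1 + Suc i)" using i(1) n_pos by (simp add: add.commute)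
  ultimately have "valley_walk X prec c n u"
    using i by unfold_locales (auto simp: du Pu)
  then show ?thesis by blast
qed

end

section \<open>The forbidden poset on a shortest bad walk\<close>

text \<open>
  Now \<open>v 1, \<dots>, v m\<close> is the \<open>x\<close> chain, \<open>v (m + 1)\<close> is
  \<open>a\<close>, and \<open>v (m + 2), \<dots>, v (n - 1)\<close> is the \<open>y\<close> chain, from
  its top to its bottom. The point \<open>b\<close> is \<open>v n = v 0\<close>; with the index
  \<open>n\<close> it is the end of the descent.
\<close>
locale single_valley_walk = valley_walk +
  fixes m :: nat
  assumes m_ge: "1 \<le> m" and m_le: "m + 3 \<le> n"
    and down_iff: "k < n \<Longrightarrow> down k \<longleftrightarrow> m < k"
begin

lemma P_rise: "k \<le> m \<Longrightarrow> P (Suc k) = P k + w k"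
  using P_up[of k] down_iff[of k] m_le by simp

lemma P_fall: "m < k \<Longrightarrow> k < n \<Longrightarrow> P (Suc k) = P k - w (Suc k)"
  using P_down[of k] down_iff[of k] by simp

lemma v_eq_iff:
  assumes "i \<in> {1..n}" "j \<in> {1..n}"
  shows "v i = v j \<longleftrightarrow> i = j"
proof -
  have *: "v i \<noteq> v j" if ij: "1 \<le> i" "i < j" "j \<le> n" for i j
  proof -
    obtain d where d: "j = i + d" using ij by (metis less_imp_le le_Suc_ex)
    with ij have "0 < d" "d < n" by simp_all
    with distinct_step d show ?thesis by metis
  qed
  show ?thesis
    using assms *[of i j] *[of j i] by (cases i j rule: linorder_cases) auto
qed

lemma descent_order:
  assumes "m < i" "m < j" "i \<le> n" "j \<le> n"
  shows "prec (v j) (v i) \<longleftrightarrow> i < j"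
proof -
  have *: "prec (v j) (v i)" if "m < i" "i < j" "j \<le> n" for i j
    using down_run[of i j] down_iff that by simp
  show ?thesis
    using *[of i j] *[of j i] asym[of "v i" "v j"] irrefl[of "v i"] assms
    by (cases i j rule: linorder_cases) auto
qed

text \<open>
  If \<open>\<delta> \<ge> 1\<close>, the later levels avoid two consecutive integers at the right end of
  \<open>v 1\<close>, so no step can just cross them. An ascent that goes on beyond \<open>v 2\<close> would
  have to come back across them. If \<open>v 2\<close> is the top, the first step of the descent has to leap
  down to \<open>P 1\<close> or further, so by \<open>above_root\<close> it is the last one before
  \<open>b\<close>, and the walk has only four points.
\<close>
lemma delta_eq_0:
  assumes "5 \<le> n"
  shows "\<delta> = 0"
proof (rule ccontr)
  assume "\<delta> \<noteq> 0"
  then have d: "1 \<le> \<delta>" using \<delta>_nonneg by simp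
  have avoid: "P k < P 2 - \<delta> \<or> P 2 < P k" if "3 \<le> k" "k < n" for k
    using level_gap_avoids[of "k - 1" 1] that P_2 by simp
  show False
  proof (cases "m = 1")
    case True
    have P3: "P 3 = P 2 - w 3"
      using P_fall[of 2] True assms by (simp add: numeral_3_eq_3 numeral_2_eq_2)
    then have "P 3 \<le> P 1" using avoid[of 3] assms d w12[of 3] w12[of 1] P_2 by auto
    with above_root[of 3] assms show False by simp
  next
    case False
    then have "P 3 = P 2 + w 2"
      using P_rise[of 2] m_ge by (simp add: numeral_3_eq_3 numeral_2_eq_2)
    then have "P 2 < P 3" using w12[of 2] by auto
    moreover have "P (n - 1) \<le> P 2" using P_last P_2 w12[of 1] d by auto
    moreover have "3 \<le> n - 1" using assms by simp
    ultimately obtain k where k: "3 \<le> k" "k < n - 1" "P 2 < P k" "P (Suc k) \<le> P 2"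
      using int_crossing_down[of 3 "n - 1" "P 2" P] by blast
    have "P (Suc k) < P 2 - \<delta>" using avoid[of "Suc k"] k by simp
    moreover have "P k - 2 \<le> P (Suc k)"
      using P_up[of k] P_down[of k] w12[of k] w12[of "Suc k"] by (cases "down k") auto
    ultimately show False using k d by simp
  qed
qed

lemma three_plus_one_induced:
  assumes "n = 4" and f: "\<And>x. x \<in> X \<Longrightarrow> f x = real_of_int (c x)"
  shows "\<exists>Q\<in>three_plus_one. induced_in Q (X, prec, f)"
proof -
  have m: "m = 1" using m_ge m_le assms by simp
  define J :: "point \<Rightarrow> nat" where
    "J u = (case u of PB \<Rightarrow> 4 | PY _ \<Rightarrow> 3 | PA \<Rightarrow> 2 | PX _ \<Rightarrow> 1)" for u
  let ?S = "{PA, PY 0, PB, PX 0}"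
  let ?R = "\<lambda>u v. (u, v) \<in> {(PB, PY 0), (PY 0, PA), (PB, PA)}"
  have J_in: "J u \<in> {1..n}" for u by (cases u) (simp_all add: J_def assms)
  have J_inj: "J u = J u' \<longleftrightarrow> u = u'" if "u \<in> ?S" "u' \<in> ?S" for u u'
    using that by (auto simp: J_def)
  have ch: "prec (v 4) (v 3)" "prec (v 3) (v 2)" "prec (v 4) (v 2)"
    using descent_order[of 3 4] descent_order[of 2 3] descent_order[of 2 4] m assms by simp_all
  have x12: "\<not> prec (v 1) (v 2)" "\<not> prec (v 2) (v 1)"
    using up_not_prec[OF up_1] by (simp_all add: numeral_2_eq_2)
  have x14: "\<not> prec (v 1) (v 4)" "\<not> prec (v 4) (v 1)"
    using up_not_prec[OF up_0] v_n assms by simp_all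
  have x13: "\<not> prec (v 1) (v 3)" "\<not> prec (v 3) (v 1)"
    using trans[of "v 1" "v 3" "v 2"] trans[of "v 4" "v 3" "v 1"] ch x12 x14 by auto
  have order: "?R u u' \<longleftrightarrow> prec (v (J u)) (v (J u'))" if "u \<in> ?S" "u' \<in> ?S" for u u'
    using that ch x12 x13 x14 irrefl[OF v_in] asym[OF ch(1)] asym[OF ch(2)] asym[OF ch(3)]
    by (auto simp: J_def)
  have "w 1 + P 1 - w 3 \<le> P 1"
    using P_fall[of 2] P_2 P_last \<delta>_nonneg m assms by (simp add: numeral_3_eq_3 numeral_2_eq_2)
  then have "w 3 = 2 \<or> w 1 = 1" using w12[of 1] w12[of 3] by auto
  then have weights: "f (v 3) = 2 \<or> f (v 1) = 1" by (auto simp: f)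
  have "f (v i) \<in> {1, 2}" for i using w12[of i] by (auto simp: f)
  with weights have "(?S, ?R, \<lambda>u. f (v (J u))) \<in> three_plus_one"
    unfolding three_plus_one_def by (auto simp: J_def)
  moreover have "induced_in (?S, ?R, \<lambda>u. f (v (J u))) (X, prec, f)"
    unfolding induced_in.simps
  proof (intro exI[of _ "\<lambda>u. v (J u)"] conjI ballI)
    show "inj_on (\<lambda>u. v (J u)) ?S"
      using v_eq_iff[OF J_in J_in] J_inj by (intro inj_onI) blast
  qed (use order in auto)
  ultimately show ?thesis by blast
qed

end

text \<open>
  Levels are shifted such that \<open>b\<close> ends at \<open>\<kappa>\<close>. Thereby the right end
  \<open>2 \<kappa> + 1\<close> of \<open>v 1\<close> is odd, as \<open>interleave\<close> requires.
\<close>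
locale long_valley_walk = single_valley_walk +
  assumes n_ge_5: "5 \<le> n"
begin

lemma \<delta>_0: "\<delta> = 0"
  using delta_eq_0 n_ge_5 .

definition \<kappa> :: int where "\<kappa> = w 1 - 1"

definition pos :: "nat \<Rightarrow> int" where "pos i = P i - P 1 + \<kappa>"

lemma \<kappa>_cases: "\<kappa> = 0 \<or> \<kappa> = 1"
  using w12[of 1] by (auto simp: \<kappa>_def)

lemma order_far:
  assumes "i + 2 \<le> j" "j + 2 \<le> n + i"
  shows "prec (v i) (v j) \<longleftrightarrow> pos i + w i < pos j"
    and "prec (v j) (v i) \<longleftrightarrow> pos j + w j < pos i"
proof -
  show "prec (v i) (v j) \<longleftrightarrow> pos i + w i < pos j"
  proof -
    obtain d where d: "j = i + d" "2 \<le> d" "d + 2 \<le> n"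
      using assms by (intro that[of "j - i"]) auto
    show ?thesis using level_gap[OF d(2,3), of i] d(1) \<delta>_0 by (simp add: pos_def split: if_splits)
  qed
  show "prec (v j) (v i) \<longleftrightarrow> pos j + w j < pos i"
  proof -
    obtain d where d: "j + d = i + n" "2 \<le> d" "d + 2 \<le> n"
      using assms by (intro that[of "n + i - j"]) auto
    show ?thesis using level_gap[OF d(2,3), of j] d(1) \<delta>_0 P_period[of i]
      by (simp add: pos_def split: if_splits)
  qed
qed

text \<open>
  For points of the \<open>x\<close> chain the intervals of levels determine the order to all points,
  consecutive ones included: consecutive points are incomparable here, and their intervals share an endpoint.
  Consecutive points of the descent share an endpoint as well, but are comparable.
\<close>
lemma order_x:
  assumes i: "1 \<le> i" "i \<le> m" and j: "1 \<le> j" "j \<le> n"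
  shows "prec (v i) (v j) \<longleftrightarrow> pos i + w i < pos j"
    and "prec (v j) (v i) \<longleftrightarrow> pos j + w j < pos i"
proof -
  have pos_w: "0 < w k" for k using w12[of k] by auto
  have near: "\<not> prec (v k) (v (Suc k)) \<and> \<not> prec (v (Suc k)) (v k) \<and> pos (Suc k) = pos k + w k"
    if "k \<le> m" for k
    using up_not_prec[of k] P_rise[of k] down_iff[of k] that m_le by (simp add: pos_def)
  have n0: "pos n = pos 0" using P_n \<delta>_0 by (simp add: pos_def)
  consider "j = i" | "j = Suc i" | "i = Suc j" | "i = 1" "j = n"
    | "i + 2 \<le> j" "j + 2 \<le> n + i" | "j + 2 \<le> i" using i j by linarith
  then have "(prec (v i) (v j) \<longleftrightarrow> pos i + w i < pos j) \<and>
    (prec (v j) (v i) \<longleftrightarrow> pos j + w j < pos i)"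
  proof cases
    case 1
    then show ?thesis using irrefl[of "v i"] pos_w[of i] by simp
  next
    case 2
    then show ?thesis using near[of i] i pos_w[of i] pos_w[of j] by simp
  next
    case 3
    then show ?thesis using near[of j] i pos_w[of i] pos_w[of j] by simp
  next
    case 4
    then show ?thesis using near[of 0] n0 pos_w[of 0] pos_w[of 1] by simp
  next
    case 5
    then show ?thesis using order_far by blast
  next
    case 6
    then show ?thesis using order_far[of j i] i m_le by simp
  qed
  then show "prec (v i) (v j) \<longleftrightarrow> pos i + w i < pos j"
    and "prec (v j) (v i) \<longleftrightarrow> pos j + w j < pos i" by blast+
qed

lemma positions:
  "\<exists>t. int m + \<kappa> = int t + 2 \<and>
    (n = m + t + 4 \<and> pos (m + 1) = 2 * int t + 3 \<or> n = m + t + 3 \<and> pos (m + 1) = 2 * int t + 2) \<and>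
    (\<forall>i\<le>m. pos (i + 1) = max \<kappa> (min (pos (m + 1)) (2 * (int i + \<kappa>) - 1))) \<and>
    (\<forall>j. j + m + 2 \<le> n \<longrightarrow> pos (n - 1 - j) = max \<kappa> (min (pos (m + 1)) (2 * int j)))"
proof -
  define K where "K = n - m - 2"
  define x where "x i = pos (i + 1)" for i
  define y where "y j = pos (n - 1 - j)" for j
  have x_steps: "x (Suc i) = x i + w (Suc i)" if "i < m" for i
    using P_rise[of "Suc i"] that by (simp add: x_def pos_def)
  have y_steps: "y (Suc j) = y j + w (n - 1 - j)" if "j < K" for j
    using P_fall[of "n - 2 - j"] that m_le
    by (simp add: y_def pos_def K_def Suc_diff_Suc numeral_2_eq_2)
  have disjoint: "x i \<noteq> y j" if ij: "0 < i" "i < m" "0 < j" "j < K" for i j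
  proof -
    obtain d where d: "n - 1 - j = i + d" "2 \<le> d" "d + 2 \<le> n"
      using ij m_le by (intro that[of "n - 1 - j - i"]) (auto simp: K_def)
    show ?thesis
      using level_gap_avoids[OF d(2,3), of i] d(1) P_rise[of i] ij \<delta>_0
      by (auto simp: x_def y_def pos_def)
  qed
  have "\<exists>t. int m + \<kappa> = int t + 2 \<and>
    (K = t + 2 \<and> x m = 2 * int t + 3 \<or> K = t + 1 \<and> x m = 2 * int t + 2) \<and>
    (\<forall>i\<le>m. x i = max \<kappa> (min (x m) (2 * (int i + \<kappa>) - 1))) \<and>
    (\<forall>j\<le>K. y j = max \<kappa> (min (x m) (2 * int j)))"
  proof (rule interleave)
    show "\<kappa> = 0 \<or> \<kappa> = 1" by (rule \<kappa>_cases)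
    show "x 0 = \<kappa>" by (simp add: x_def pos_def)
    show "y 0 = \<kappa>" using P_last \<delta>_0 by (simp add: y_def pos_def)
    show "x 1 = 2 * \<kappa> + 1" using x_steps[of 0] m_ge by (simp add: x_def pos_def \<kappa>_def)
    show "x (Suc i) = x i + 1 \<or> x (Suc i) = x i + 2" if "i < m" for i
      using x_steps[OF that] w12[of "Suc i"] by auto
    show "y (Suc j) = y j + 1 \<or> y (Suc j) = y j + 2" if "j < K" for j
      using y_steps[OF that] w12[of "n - 1 - j"] by auto
    show "0 < m" "0 < K" "2 < m + K" using m_ge m_le n_ge_5 by (simp_all add: K_def)
    show "x m = y K" using m_le by (simp add: x_def y_def K_def)
  qed (use disjoint in blast)
  then obtain t where t: "int m + \<kappa> = int t + 2"
    "K = t + 2 \<and> x m = 2 * int t + 3 \<or> K = t + 1 \<and> x m = 2 * int t + 2"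
    "\<And>i. i \<le> m \<Longrightarrow> x i = max \<kappa> (min (x m) (2 * (int i + \<kappa>) - 1))"
    "\<And>j. j \<le> K \<Longrightarrow> y j = max \<kappa> (min (x m) (2 * int j))" by blast
  have "n = m + t + 4 \<and> pos (m + 1) = 2 * int t + 3 \<or>
      n = m + t + 3 \<and> pos (m + 1) = 2 * int t + 2"
    using t(2) m_le by (auto simp: K_def x_def)
  moreover have "\<forall>i\<le>m. pos (i + 1) = max \<kappa> (min (pos (m + 1)) (2 * (int i + \<kappa>) - 1))"
    using t(3) unfolding x_def by blast
  moreover have "\<forall>j. j + m + 2 \<le> n \<longrightarrow>
      pos (n - 1 - j) = max \<kappa> (min (pos (m + 1)) (2 * int j))"
  proof (intro allI impI)
    fix j assume "j + m + 2 \<le> n"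
    then have "j \<le> K" by (simp add: K_def)
    from t(4)[OF this] show "pos (n - 1 - j) = max \<kappa> (min (pos (m + 1)) (2 * int j))"
      unfolding x_def y_def .
  qed
  ultimately show ?thesis using t(1) by blast
qed

text \<open>
  \<open>\<kappa> = 0\<close> means that the first tile of the \<open>x\<close> chain is truncated to length
  1, so it is \<open>x\<^sub>0\<close>. The parity of the common right end \<open>T\<close> of the chains
  decides which of them has its last tile truncated: the \<open>y\<close> chain for odd \<open>T\<close>, the
  \<open>x\<close> chain for even \<open>T\<close>. In the latter case \<open>a\<close> directly continues the
  numbering of the \<open>y\<close> chain.
\<close>
lemma family_induced:
  assumes f: "\<And>x. x \<in> X \<Longrightarrow> f x = real_of_int (c x)"
  shows "\<exists>p q t. \<exists>Q\<in>family p q t. induced_in Q (X, prec, f)"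
proof -
  obtain t where t: "int m + \<kappa> = int t + 2"
    and ends: "n = m + t + 4 \<and> pos (m + 1) = 2 * int t + 3 \<or>
      n = m + t + 3 \<and> pos (m + 1) = 2 * int t + 2"
    and x_pos: "\<And>i. i \<le> m \<Longrightarrow> pos (i + 1) = max \<kappa> (min (pos (m + 1)) (2 * (int i + \<kappa>) - 1))"
    and y_pos: "\<And>j. j + m + 2 \<le> n \<Longrightarrow> pos (n - 1 - j) = max \<kappa> (min (pos (m + 1)) (2 * int j))"
    using positions by blast
  define p where "p = (\<kappa> = 0)"
  define q where "q = (n = m + t + 3)"
  define T where "T = pos (m + 1)"
  have T: "T = (if q then 2 * int t + 2 else 2 * int t + 3)" and n: "n = (if q then m + t + 3 else m + t + 4)"
    using ends by (auto simp: T_def q_def)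
  have \<kappa>: "\<kappa> = (if p then 0 else 1)" using \<kappa>_cases by (auto simp: p_def)
  have m: "m = (if p then t + 2 else t + 1)" using t \<kappa> by (auto split: if_splits)
  define S where "S = family_points p q t"
  \<comment> \<open>The place of each point on the walk; \<open>n\<close> rather than 0 for \<open>b\<close> puts it at the end of the descent.\<close>
  define J :: "point \<Rightarrow> nat" where
    "J u = (case u of PB \<Rightarrow> n | PY j \<Rightarrow> n - 1 - j | PA \<Rightarrow> m + 1 | PX i \<Rightarrow> if p then i + 1 else i)" for u
  have J_simps [simp]: "J PB = n" "J (PY j) = n - 1 - j" "J PA = m + 1" "J (PX i) = (if p then i + 1 else i)" for i j
    by (simp_all add: J_def)
  have w_pos: "0 < w k" for k using w12[of k] by auto
  have JX: "1 \<le> J (PX i)" "J (PX i) \<le> m" if "PX i \<in> S" for i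
    using that m by (auto simp: S_def)
  have X_left: "pos (J (PX i)) = max \<kappa> (min T (2 * int i - 1))" if "PX i \<in> S" for i
    using x_pos[of "J (PX i) - 1"] JX[OF that] \<kappa> by (auto simp: T_def)
  have X_right: "pos (J (PX i)) + w (J (PX i)) = max \<kappa> (min T (2 * int i + 1))" if "PX i \<in> S" for i
  proof -
    have "pos (J (PX i)) + w (J (PX i)) = pos (J (PX i) + 1)"
      using P_rise JX[OF that] by (simp add: pos_def)
    then show ?thesis using x_pos[of "J (PX i)"] JX[OF that] \<kappa> by (auto simp: T_def)
  qed
  have JY: "m < J (PY j)" "J (PY j) < n" if "PY j \<in> S" for j
    using that n by (auto simp: S_def)
  have Y_left: "pos (J (PY j)) = max \<kappa> (min T (2 * int j))" if "PY j \<in> S" for j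
    using y_pos[of j] that n by (auto simp: T_def S_def)
  have Y_right: "pos (J (PY j)) + w (J (PY j)) = max \<kappa> (min T (2 * int j + 2))"
    if "PY j \<in> S" "PY j \<noteq> family_top q t" for j
  proof -
    have j: "j + 1 + m + 2 \<le> n" using that n by (auto simp: S_def family_top_def split: if_splits)
    then have "Suc (n - 2 - j) = n - 1 - j" "m < n - 2 - j" by simp_all
    then have "pos (n - 1 - j) + w (n - 1 - j) = pos (n - 1 - (j + 1))"
      using P_fall[of "n - 2 - j"] n_pos by (simp add: pos_def numeral_2_eq_2)
    then show ?thesis using y_pos[of "j + 1"] j by (simp add: T_def add.commute)
  qed
  have A_left: "pos (Suc m) = T" by (simp add: T_def)
  have B_right: "pos (J PB) + w (J PB) = \<kappa>"
    using P_n \<delta>_0 P_1 by (simp add: pos_def)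
  have J_range: "J u \<in> {1..n}" if "u \<in> S" for u
  proof (cases u)
    case (PX i)
    then show ?thesis using JX[of i] that m_le by simp
  next
    case (PY j)
    then show ?thesis using JY[of j] that by simp
  qed (use m_le n_pos in auto)
  have J_inj: "u = u'" if "u \<in> S" "u' \<in> S" "J u = J u'" for u u'
    using that by (cases p; cases q; cases u; cases u') (auto simp: S_def m n)
  have order: "prec (v (J u)) (v (J u')) \<longleftrightarrow> right_end p t u < left_end p t u'"
    if u: "u \<in> S" and u': "u' \<in> S" for u u'
  proof -
    consider (x_left) i where "u = PX i" | (x_right) i where "u' = PX i" "\<And>j. u \<noteq> PX j"
      | (chain) "\<And>i. u \<noteq> PX i" "\<And>i. u' \<noteq> PX i"
      by (cases u; cases u') auto
    then show ?thesis
    proof cases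
      case x_left
      have "prec (v (J u)) (v (J u')) \<longleftrightarrow> max \<kappa> (min T (2 * int i + 1)) < pos (J u')"
        using order_x(1) JX[of i] J_range[OF u'] X_right[of i] u x_left by simp
      also have "\<dots> \<longleftrightarrow> right_end p t u < left_end p t u'"
      proof (cases u')
        case (PX j)
        then show ?thesis using X_left[of j] u u' x_left \<kappa> T
          by (cases "i + 2 \<le> j") (auto simp: S_def max_def min_def split: if_splits)
      next
        case (PY j)
        then show ?thesis using Y_left[of j] u u' x_left \<kappa> T by (auto simp: S_def split: if_splits)
      next
        case PA
        then show ?thesis using u u' x_left \<kappa> T by (auto simp: S_def A_left split: if_splits)
      next
        case PB
        then show ?thesis using B_right w_pos[of n] u u' x_left \<kappa> T by (auto simp: S_def split: if_splits)
      qed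
      finally show ?thesis .
    next
      case x_right
      have "prec (v (J u)) (v (J u')) \<longleftrightarrow> pos (J u) + w (J u) < max \<kappa> (min T (2 * int i - 1))"
        using order_x(2) JX[of i] J_range[OF u] X_left[of i] u' x_right by simp
      also have "\<dots> \<longleftrightarrow> right_end p t u < left_end p t u'"
      proof (cases u)
        case (PX j)
        then show ?thesis using x_right by simp
      next
        case (PY j)
        show ?thesis
        proof (cases "u = family_top q t")
          case True
          then have "T < pos (J u) + w (J u)" "left_end p t u' \<le> right_end p t u"
            using PY Y_left[of j] w_pos[of "J u"] u u' x_right T \<kappa>
            by (auto simp: S_def family_top_def split: if_splits)
          then show ?thesis using T \<kappa> by auto
        next
          case False
          then show ?thesis
            using PY Y_right[of j] u u' x_right \<kappa> T by (auto simp: S_def family_top_def split: if_splits)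
        qed
      next
        case PA
        then show ?thesis
          using u u' x_right w_pos[of "J u"] \<kappa> T by (auto simp: S_def A_left split: if_splits)
      next
        case PB
        then show ?thesis using B_right u u' x_right \<kappa> T by (auto simp: S_def split: if_splits)
      qed
      finally show ?thesis .
    next
      case chain
      then have gt: "m < J u" "m < J u'"
        using JY u u' m_le by (cases u; cases u'; force)+
      have "prec (v (J u)) (v (J u')) \<longleftrightarrow> J u' < J u"
        using descent_order[OF gt(2) gt(1)] J_range u u' by simp
      also have "\<dots> \<longleftrightarrow> right_end p t u < left_end p t u'"
        using chain u u' n by (cases u; cases u') (auto simp: S_def split: if_splits)
      finally show ?thesis .
    qed
  qed
  define g where "g u = f (v (J u))" for u
  have g: "g u = real_of_int (w (J u))" for u by (simp add: g_def f)
  have g12: "g u \<in> {1, 2}" for u using w12[of "J u"] by (auto simp: g)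
  have weights: "g u = (if u \<in> family_light p q t then 1 else 2)"
    if u: "u \<in> S" "u \<noteq> family_top q t" "u \<noteq> PB" for u
  proof (cases u)
    case (PX i)
    have "w (J u) = max \<kappa> (min T (2 * int i + 1)) - max \<kappa> (min T (2 * int i - 1))"
      using X_left[of i] X_right[of i] u PX by simp
    then show ?thesis using PX u T \<kappa> by (auto simp: g S_def family_light_def split: if_splits)
  next
    case (PY j)
    have "w (J u) = max \<kappa> (min T (2 * int j + 2)) - max \<kappa> (min T (2 * int j))"
      using Y_left[of j] Y_right[of j] u PY by simp
    then show ?thesis
      using PY u T \<kappa> by (auto simp: g S_def family_light_def family_top_def split: if_splits)
  next
    case PA
    with u show ?thesis by (auto simp: S_def family_top_def)
  qed (use u in auto)
  have "(S, family_order p q t, g) \<in> family p q t"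
    using g12 weights unfolding family_def family_posets_def S_def by blast
  moreover have "induced_in (S, family_order p q t, g) (X, prec, f)"
    unfolding induced_in.simps
  proof (intro exI[of _ "\<lambda>u. v (J u)"] conjI ballI)
    show "inj_on (\<lambda>u. v (J u)) S"
      using v_eq_iff[OF J_range J_range] J_inj by (intro inj_onI) blast
    show "family_order p q t u u' \<longleftrightarrow> prec (v (J u)) (v (J u'))" if "u \<in> S" "u' \<in> S" for u u'
      using order[OF that] family_order_iff[of u p q t u'] that by (simp add: S_def)
  qed (auto simp: g_def)
  ultimately show ?thesis by blast
qed

end

context weighted_interval_order
begin

lemma bad_walk_imp_forbidden:
  assumes "bad_walk n v" and f: "\<And>x. x \<in> X \<Longrightarrow> f x = real_of_int (c x)"
  shows "\<exists>Q\<in>forbidden. induced_in Q (X, prec, f)"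
proof -
  define n0 where "n0 = (LEAST n. \<exists>v. bad_walk n v)"
  have "\<exists>v. bad_walk n0 v" unfolding n0_def by (rule LeastI2_ex) (use assms in blast)+
  then obtain v0 where "bad_walk n0 v0" by blast
  moreover have "n0 \<le> k" if "bad_walk k u" for k u
    unfolding n0_def by (rule Least_le) (use that in blast)
  ultimately interpret s: shortest_walk X prec c n0 v0
    by unfold_locales (simp add: shortest_bad_walk_def)
  obtain u where "valley_walk X prec c n0 u" using s.ex_valley_walk by blast
  then interpret valley_walk X prec c n0 u .
  obtain m where "1 \<le> m" "m + 3 \<le> n0" "\<forall>k<n0. down k \<longleftrightarrow> m < k" using single_run by blast
  then interpret single_valley_walk X prec c n0 u m by unfold_locales auto
  show ?thesis
  proof (cases "n0 = 4")
    case True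
    from three_plus_one_induced[OF True f] show ?thesis unfolding forbidden_family by blast
  next
    case False
    then interpret long_valley_walk X prec c n0 u m
      using n_ge_4 by unfold_locales simp
    from family_induced[OF f] show ?thesis unfolding forbidden_family by blast
  qed
qed

end

section \<open>Potentials and negative cycles\<close>

text \<open>
  A closed walk with a repeated vertex splits into two shorter ones, one of which is negative.
\<close>
lemma (in wf_digraph) negative_closed_walk_imp_negative_cycle:
  assumes "awalk u p u" "awalk_cost h p < 0"
  shows "\<exists>q. cycle q \<and> awalk_cost h q < 0"
  using assms
proof (induction "length p" arbitrary: u p rule: less_induct)
  case less
  have ne: "p \<noteq> []" using less.prems(2) by auto
  show ?case
  proof (cases "distinct (tl (awalk_verts u p))")
    case True
    with less.prems ne show ?thesis unfolding cycle_def by blast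
  next
    case False
    obtain e p' where p: "p = e # p'" using ne by (cases p) auto
    let ?z = "head G e"
    have walk': "awalk ?z p' u" and e: "e \<in> arcs G" "tail G e = u"
      using less.prems(1) p by (auto simp: awalk_Cons_iff)
    have "\<not> distinct (awalk_verts ?z p')" using False p by simp
    then obtain q r s where p': "p' = q @ r @ s" and r: "r \<noteq> []" and "\<exists>y. awalk ?z q y \<and> awalk y r y \<and> awalk y s u"
      using awalk_not_distinct_decomp[OF walk'] by (metis length_greater_0_conv)
    then obtain y where y: "awalk ?z q y" "awalk y r y" "awalk y s u" by blast
    have rest: "awalk u (e # q @ s) u" using y e by (auto simp: awalk_Cons_iff)
    have "awalk_cost h r < 0 \<or> awalk_cost h (e # q @ s) < 0"
      using less.prems(2) p p' by auto
    then show ?thesis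
      using less.hyps[of r y] less.hyps[of "e # q @ s" u] y rest r p p' by auto
  qed
qed

text \<open>
  The potential of a vertex is the least cost of a path that ends there, the start being free. As no start has
  to reach all vertices, the digraph need not be connected.
\<close>
lemma (in fin_digraph) no_negative_cycle_imp_potential:
  assumes "\<not> (\<exists>p. cycle p \<and> awalk_cost h p < 0)"
  shows "\<exists>\<pi> :: 'a \<Rightarrow> real. \<forall>e\<in>arcs G. \<pi> (head G e) \<le> \<pi> (tail G e) + h e"
proof -
  have no_neg: "\<not> (\<exists>w c. awalk w c w \<and> w \<in> set (awalk_verts u p) \<and> awalk_cost h c < 0)" for u p
    using assms negative_closed_walk_imp_negative_cycle by blast
  define A where "A x = (\<Union>u\<in>verts G. {p. apath u p x})" for x
  define \<pi> where "\<pi> x = Min (awalk_cost h ` A x)" for x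
  have fin: "finite (A x)" for x unfolding A_def using apaths_finite by simp
  have nonempty: "A x \<noteq> {}" if "x \<in> verts G" for x
  proof -
    have "apath x [] x" using that by (simp add: apath_Nil_iff)
    then show ?thesis using that unfolding A_def by blast
  qed
  have "\<pi> (head G e) \<le> \<pi> (tail G e) + h e" if e: "e \<in> arcs G" for e
  proof -
    have "\<pi> (tail G e) \<in> awalk_cost h ` A (tail G e)"
      unfolding \<pi>_def using fin nonempty e by (intro Min_in) auto
    then obtain u p where p: "apath u p (tail G e)" "\<pi> (tail G e) = awalk_cost h p"
      unfolding A_def by blast
    have walk: "awalk u (p @ [e]) (head G e)"
      using p(1) e by (auto simp: apath_def arc_implies_awalk intro: awalk_appendI)
    then have "apath u (awalk_to_apath (p @ [e])) (head G e)" by (rule apath_awalk_to_apath)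
    moreover from this have "u \<in> verts G" by (auto simp: apath_def)
    ultimately have "awalk_to_apath (p @ [e]) \<in> A (head G e)"
      unfolding A_def by blast
    then have "\<pi> (head G e) \<le> awalk_cost h (awalk_to_apath (p @ [e]))"
      unfolding \<pi>_def using fin by simp
    also have "\<dots> \<le> awalk_cost h (p @ [e])"
      by (rule awalk_to_path_no_neg_cyc_cost[OF walk no_neg])
    also have "\<dots> = \<pi> (tail G e) + h e" using p(2) by simp
    finally show ?thesis .
  qed
  then show ?thesis by blast
qed

section \<open>Representations, cycles and bad walks\<close>

context weighted_interval_order
begin

abbreviation real_weight :: "'a \<Rightarrow> real" where "real_weight x \<equiv> real_of_int (c x)"

lemma finite_X: "finite X"
  using interval_order unfolding interval_order_def poset_def by simp

lemma G_simps:
  "verts (G_digraph X prec) = X" "tail (G_digraph X prec) e = fst e"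
  "head (G_digraph X prec) e = snd e"
  by (simp_all add: G_digraph_def)

lemma fin_digraph_G: "fin_digraph (G_digraph X prec)"
proof
  show "finite (arcs (G_digraph X prec))"
    by (rule finite_subset[of _ "X \<times> X"]) (auto simp: G_digraph_def finite_X)
qed (auto simp: G_digraph_def finite_X)

lemma arc_iff: "(x, y) \<in> arcs (G_digraph X prec) \<longleftrightarrow> arc x y"
  by (simp add: G_digraph_def arc_def)

text \<open>
  The \<open>\<epsilon>\<close> terms of a cycle sum up to less than 1, so its integral weight is below 1 if the
  cycle is negative.
\<close>
lemma bad_walk_if_negative_cycle:
  assumes f: "\<And>x. x \<in> X \<Longrightarrow> f x = real_weight x"
    and \<epsilon>: "0 < \<epsilon>" "\<epsilon> * real (card X) < 1"
    and neg: "negative_cycle (G_digraph X prec) (G_weight \<epsilon> prec f) p"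
  shows "\<exists>n v. bad_walk n v"
proof -
  interpret G: fin_digraph "G_digraph X prec" by (rule fin_digraph_G)
  define n where "n = length p"
  obtain u where u: "G.awalk u p u" "distinct (tl (G.awalk_verts u p))" "p \<noteq> []"
    using neg unfolding negative_cycle_def G.cycle_def by blast
  have n_pos: "0 < n" using u(3) by (simp add: n_def)
  have "n = card (set (tl (G.awalk_verts u p)))"
    using u(2) by (simp add: distinct_card G.length_awalk_verts n_def)
  also have "\<dots> \<le> card X"
  proof (rule card_mono[OF finite_X])
    have "set (G.awalk_verts u p) \<subseteq> verts (G_digraph X prec)"
      using u(1) unfolding G.awalk_conv by blast
    then show "set (tl (G.awalk_verts u p)) \<subseteq> X"
      using list.set_sel(2)[OF G.awalk_verts_non_Nil] by (auto simp: G_simps)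
  qed
  finally have "n \<le> card X" .
  define v where "v i = fst (p ! (i mod n))" for i
  have walk: "\<forall>i<length p. arc (fst (p ! i)) (snd (p ! i)) \<and>
      snd (p ! i) = (if Suc i < length p then fst (p ! Suc i) else y)"
    if "G.awalk x p y" for x y p
    using that
  proof (induction p arbitrary: x)
    case (Cons e p)
    then have e: "arc (fst e) (snd e)" and p: "G.awalk (snd e) p y"
      using arc_iff[of "fst e" "snd e"] by (auto simp: G.awalk_Cons_iff G_simps)
    have snd_e: "snd e = (if p \<noteq> [] then fst (p ! 0) else y)"
      using p by (cases p) (auto simp: G.awalk_simps G_simps)
    show ?case
    proof (intro allI impI)
      fix i assume "i < length (e # p)"
      show "arc (fst ((e # p) ! i)) (snd ((e # p) ! i)) \<and>
          snd ((e # p) ! i) = (if Suc i < length (e # p) then fst ((e # p) ! Suc i) else y)"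
      proof (cases i)
        case 0
        with e snd_e show ?thesis by simp
      next
        case (Suc k)
        with \<open>i < length (e # p)\<close> have "k < length p" by simp
        with Cons.IH[OF p] show ?thesis
          unfolding Suc nth_Cons_Suc length_Cons Suc_less_eq by blast
      qed
    qed
  qed simp
  have "fst (p ! 0) = u" using u by (cases p) (auto simp: G.awalk_simps G_simps)
  have step: "p ! (i mod n) = (v i, v (Suc i))" "arc (v i) (v (Suc i))" for i
  proof -
    have lt: "i mod n < length p" using n_pos by (simp add: n_def)
    have "snd (p ! (i mod n)) = v (Suc i)"
    proof (cases "Suc (i mod n) < n")
      case True
      then have "Suc i mod n = Suc (i mod n)" by (simp add: mod_Suc)
      then show ?thesis using walk[OF u(1)] lt True by (simp add: v_def n_def)
    next
      case False
      then have "Suc (i mod n) = n" using lt n_def by simp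
      then have "Suc i mod n = 0" by (simp add: mod_Suc)
      then show ?thesis
        using walk[OF u(1)] lt False \<open>fst (p ! 0) = u\<close> by (simp add: v_def n_def)
    qed
    then show eq: "p ! (i mod n) = (v i, v (Suc i))" by (simp add: v_def prod_eq_iff)
    then show "arc (v i) (v (Suc i))" using walk[OF u(1)] lt by force
  qed
  have closed: "closed_walk n v" using n_pos step(2) by (simp add: closed_walk_def v_def)
  have w: "G_weight \<epsilon> prec f (p ! i) \<ge> wt (v i) (v (Suc i)) - \<epsilon>" if "i < n" for i
  proof -
    have "p ! i = (v i, v (Suc i))" "v i \<in> X" "v (Suc i) \<in> X"
      using step[of i] that arc_in by auto
    then show ?thesis using f \<epsilon> by (simp add: G_weight_def wt_def)
  qed
  have "real_of_int (level v n) - \<epsilon> * real n =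
      (\<Sum>i<n. real_of_int (wt (v i) (v (Suc i))) - \<epsilon>)"
    by (simp add: level_def sum_subtractf)
  also have "\<dots> \<le> (\<Sum>i<n. G_weight \<epsilon> prec f (p ! i))"
    using w by (intro sum_mono) auto
  also have "\<dots> = sum_list (map (G_weight \<epsilon> prec f) p)"
    by (simp add: sum_list_sum_nth n_def atLeast0LessThan)
  also have "\<dots> < 0" using neg by (simp add: negative_cycle_def)
  finally have "real_of_int (level v n) < \<epsilon> * real n" by simp
  also have "\<dots> \<le> \<epsilon> * real (card X)" using \<open>n \<le> card X\<close> \<epsilon> by simp
  finally have "level v n < 1" using \<epsilon>(2) by linarith
  with closed show ?thesis unfolding bad_walk_def by force
qed

text \<open>
  The slacks of the inequalities along a closed walk sum up to its weight. If that is at most 0, all of them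
  vanish. But the inequality of a descending step is strict, so the walk only ascends, and its weight is
  positive.
\<close>
lemma representation_imp_no_bad_walk:
  fixes L :: "'a \<Rightarrow> real"
  assumes L: "\<And>x y. x \<in> X \<Longrightarrow> y \<in> X \<Longrightarrow> prec x y \<longleftrightarrow> L x + c x < L y"
  shows "\<not> bad_walk n v"
proof
  assume bad: "bad_walk n v"
  have arcs: "arc (v i) (v (Suc i))" for i
    using bad by (simp add: bad_walk_def closed_walk_def)
  define s where "s i = L (v i) + wt (v i) (v (Suc i)) - L (v (Suc i))" for i
  have s_nonneg: "0 \<le> s i" and s_down: "prec (v (Suc i)) (v i) \<Longrightarrow> 0 < s i" for i
    using arcs[of i] L[of "v i" "v (Suc i)"] L[of "v (Suc i)" "v i"]
    by (auto simp: s_def wt_def arc_def incomparable_def)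
  have "(\<Sum>i<k. s i) = L (v 0) + level v k - L (v k)" for k
    by (induction k) (simp_all add: s_def level_Suc)
  from this[of n] have sum: "(\<Sum>i<n. s i) = level v n"
    using bad by (simp add: bad_walk_def closed_walk_def) (metis add_0)
  then have "(\<Sum>i<n. s i) \<le> 0" using bad by (simp add: bad_walk_def)
  then have "(\<Sum>i<n. s i) = 0" using s_nonneg by (simp add: order_antisym sum_nonneg)
  then have "s i = 0" if "i < n" for i
    using s_nonneg that by (subst (asm) sum_nonneg_eq_0_iff) auto
  then have "wt (v i) (v (Suc i)) \<ge> 1" if "i < n" for i
    using that s_down[of i] weight[of "v i"] arc_in(1)[OF arcs[of i]] by (auto simp: wt_def)
  then have "(\<Sum>i<n. 1) \<le> level v n" unfolding level_def by (intro sum_mono) auto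
  then show False using bad by (simp add: bad_walk_def closed_walk_def)
qed

lemma potential_imp_representation:
  assumes f: "\<And>x. x \<in> X \<Longrightarrow> f x = real_weight x" and \<epsilon>: "0 < \<epsilon>"
    and \<pi>: "\<And>x y. arc x y \<Longrightarrow> \<pi> y \<le> \<pi> x + G_weight \<epsilon> prec f (x, y)"
    and x: "x \<in> X" and y: "y \<in> X"
  shows "prec x y \<longleftrightarrow> \<pi> x + c x < \<pi> y"
proof -
  have fwd: "\<pi> x + c x < \<pi> y" if "prec x y" "x \<in> X" "y \<in> X" for x y
    using \<pi>[of y x] that f \<epsilon> by (simp add: G_weight_def arc_def)
  have inc: "\<pi> y \<le> \<pi> x + c x" if "incomparable prec x y" "x \<in> X" "y \<in> X" for x y
    using \<pi>[of x y] that f by (simp add: G_weight_def arc_def incomparable_def)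
  have pos: "0 < c x" "0 < c y" using weight[OF x] weight[OF y] by auto
  consider "prec x y" | "prec y x" | "x = y" | "incomparable prec x y"
    by (auto simp: incomparable_def)
  then show ?thesis
  proof cases
    case 1
    then show ?thesis using fwd x y by simp
  next
    case 2
    then show ?thesis using fwd[OF 2 y x] asym[OF 2 y x] pos by simp
  next
    case 3
    then show ?thesis using irrefl x pos by simp
  next
    case 4
    then show ?thesis using inc[OF 4 x y] by (simp add: incomparable_def)
  qed
qed

text \<open>A representation with prescribed lengths is determined by its left endpoints.\<close>
lemma representable_iff:
  assumes f: "\<And>x. x \<in> X \<Longrightarrow> f x = real_weight x"
  shows "(\<exists>I. interval_representation X prec I \<and> (\<forall>x\<in>X. measure lborel (I x) = f x)) \<longleftrightarrow>
    (\<exists>L :: 'a \<Rightarrow> real. \<forall>x\<in>X. \<forall>y\<in>X. prec x y \<longleftrightarrow> L x + c x < L y)"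
proof
  assume "\<exists>I. interval_representation X prec I \<and> (\<forall>x\<in>X. measure lborel (I x) = f x)"
  then obtain I where I: "\<forall>x\<in>X. \<exists>l r. l \<le> r \<and> I x = {l..r}"
    "\<forall>x\<in>X. \<forall>y\<in>X. prec x y \<longleftrightarrow> completely_left (I x) (I y)"
    "\<forall>x\<in>X. measure lborel (I x) = f x"
    unfolding interval_representation_def by blast
  then obtain l r where lr: "\<And>x. x \<in> X \<Longrightarrow> l x \<le> r x" "\<And>x. x \<in> X \<Longrightarrow> I x = {l x..r x}"
    by metis
  have "r x = l x + c x" if "x \<in> X" for x
  proof -
    have "r x - l x = c x" using I(3) lr that f by fastforce
    then show ?thesis by simp
  qed
  then have "prec x y \<longleftrightarrow> l x + c x < l y" if "x \<in> X" "y \<in> X" for x y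
  proof -
    have "prec x y \<longleftrightarrow> completely_left {l x..r x} {l y..r y}" using I(2) lr(2) that by metis
    then show ?thesis
      unfolding completely_left_intervals[OF lr(1)[OF that(1)] lr(1)[OF that(2)]]
      using \<open>\<And>x. x \<in> X \<Longrightarrow> r x = l x + real_weight x\<close> that by simp
  qed
  then show "\<exists>L :: 'a \<Rightarrow> real. \<forall>x\<in>X. \<forall>y\<in>X. prec x y \<longleftrightarrow> L x + c x < L y" by blast
next
  assume "\<exists>L :: 'a \<Rightarrow> real. \<forall>x\<in>X. \<forall>y\<in>X. prec x y \<longleftrightarrow> L x + c x < L y"
  then obtain L :: "'a \<Rightarrow> real" where L: "\<And>x y. x \<in> X \<Longrightarrow> y \<in> X \<Longrightarrow> prec x y \<longleftrightarrow> L x + c x < L y" by blast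
  define I where "I x = {L x..L x + c x}" for x
  have le: "L x \<le> L x + c x" if "x \<in> X" for x using weight[OF that] by auto
  have "prec x y \<longleftrightarrow> completely_left (I x) (I y)" if "x \<in> X" "y \<in> X" for x y
    unfolding I_def completely_left_intervals[OF le[OF that(1)] le[OF that(2)]]
    by (rule L[OF that])
  then have "interval_representation X prec I"
    unfolding interval_representation_def using le I_def by blast
  moreover have "measure lborel (I x) = f x" if "x \<in> X" for x
    unfolding I_def measure_lborel_Icc[OF le[OF that]] f[OF that] by simp
  ultimately show "\<exists>I. interval_representation X prec I \<and> (\<forall>x\<in>X. measure lborel (I x) = f x)"
    by blast
qed

end

section \<open>The characterization\<close>

theorem theorem13:
  fixes X :: "'a set" and prec :: "'a \<Rightarrow> 'a \<Rightarrow> bool" and f :: "'a \<Rightarrow> real" and \<epsilon> :: real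
  assumes "interval_order X prec"
    and "\<forall>x\<in>X. f x \<in> {1, 2}"
    and "0 < \<epsilon>"
    and "X \<noteq> {} \<longrightarrow> \<epsilon> < 1 / (real (card X))\<^sup>2"
  shows "((\<exists>I. interval_representation X prec I \<and> (\<forall>x\<in>X. measure lborel (I x) = f x)) \<longleftrightarrow>
           \<not> (\<exists>p. negative_cycle (G_digraph X prec) (G_weight \<epsilon> prec f) p)) \<and>
         (\<not> (\<exists>p. negative_cycle (G_digraph X prec) (G_weight \<epsilon> prec f) p) \<longleftrightarrow>
           (\<forall>Q\<in>forbidden. \<not> induced_in Q (X, prec, f)))"
proof -
  define c where "c x = \<lfloor>f x\<rfloor>" for x
  have f: "f x = real_of_int (c x)" if "x \<in> X" for x
    using assms(2) that by (auto simp: c_def)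
  interpret weighted_interval_order X prec c
    using assms(1,2) by unfold_locales (auto simp: c_def)
  have \<epsilon>: "\<epsilon> * real (card X) < 1"
  proof (cases "X = {}")
    case False
    then have k: "1 \<le> real (card X)" using finite_X by (simp add: Suc_leI card_gt_0_iff)
    have "\<epsilon> * real (card X) \<le> \<epsilon> * (real (card X))\<^sup>2"
      using k assms(3) by (simp add: power2_eq_square)
    also have "\<dots> < 1" using assms(4) False k by (simp add: field_simps)
    finally show ?thesis .
  qed simp
  define rep where "rep \<longleftrightarrow> (\<exists>L :: 'a \<Rightarrow> real. \<forall>x\<in>X. \<forall>y\<in>X. prec x y \<longleftrightarrow> L x + c x < L y)"
  define neg where "neg \<longleftrightarrow> (\<exists>p. negative_cycle (G_digraph X prec) (G_weight \<epsilon> prec f) p)"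
  define forb where "forb \<longleftrightarrow> (\<exists>Q\<in>forbidden. induced_in Q (X, prec, f))"
  have "rep \<Longrightarrow> \<not> neg"
    using representation_imp_no_bad_walk bad_walk_if_negative_cycle[OF f assms(3) \<epsilon>]
    unfolding rep_def neg_def by blast
  moreover have "\<not> neg \<Longrightarrow> rep"
  proof -
    assume "\<not> neg"
    interpret G: fin_digraph "G_digraph X prec" by (rule fin_digraph_G)
    have "\<not> (\<exists>p. G.cycle p \<and> G.awalk_cost (G_weight \<epsilon> prec f) p < 0)"
      using \<open>\<not> neg\<close> unfolding neg_def negative_cycle_def G.awalk_cost_def by simp
    from G.no_negative_cycle_imp_potential[OF this] obtain \<pi> :: "'a \<Rightarrow> real" where
      "\<forall>e\<in>arcs (G_digraph X prec). \<pi> (snd e) \<le> \<pi> (fst e) + G_weight \<epsilon> prec f e"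
      unfolding G_simps by blast
    then have "\<pi> y \<le> \<pi> x + G_weight \<epsilon> prec f (x, y)" if "arc x y" for x y
      using that arc_iff[of x y] by fastforce
    from potential_imp_representation[OF f assms(3) this]
    show rep unfolding rep_def by blast
  qed
  moreover have "neg \<Longrightarrow> forb"
    using bad_walk_if_negative_cycle[OF f assms(3) \<epsilon>] bad_walk_imp_forbidden[OF _ f]
    unfolding neg_def forb_def by blast
  moreover have "forb \<Longrightarrow> \<not> rep"
  proof
    assume forb rep
    obtain L :: "'a \<Rightarrow> real" where L: "\<forall>x\<in>X. \<forall>y\<in>X. prec x y \<longleftrightarrow> L x + c x < L y"
      using \<open>rep\<close> unfolding rep_def by blast
    obtain S R g \<phi> where Q: "(S, R, g) \<in> forbidden" and \<phi>: "\<phi> ` S \<subseteq> X"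
      "\<forall>u\<in>S. \<forall>v\<in>S. R u v \<longleftrightarrow> prec (\<phi> u) (\<phi> v)" "\<forall>u\<in>S. g u = f (\<phi> u)"
      using \<open>forb\<close> unfolding forb_def by auto
    have "R u v \<longleftrightarrow> L (\<phi> u) + g u < L (\<phi> v)" if "u \<in> S" "v \<in> S" for u v
      using L \<phi> that f[of "\<phi> u"] by (simp add: image_subset_iff)
    from forbidden_not_representable[OF Q this] show False .
  qed
  ultimately have "(rep \<longleftrightarrow> \<not> neg) \<and> (\<not> neg \<longleftrightarrow> \<not> forb)" by blast
  moreover have "(\<exists>I. interval_representation X prec I \<and> (\<forall>x\<in>X. measure lborel (I x) = f x)) \<longleftrightarrow> rep"
    unfolding rep_def by (rule representable_iff) (rule f)
  ultimately show ?thesis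
    unfolding neg_def forb_def by blast
qed

end
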